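(* Let $n \geq 2$, let $\mathbf{B}=[\mathbf{b}_1,\dots,\mathbf{b}_n]$ be a basis of a full-rank lattice $L \subset \mathbb{R}^n$, let $M=\max\{\|\mathbf{b}_1\|,\dots,\|\mathbf{b}_n\|\}$ for this input basis, and put $\alpha = M^n/\mathrm{vol}(L)$ (so $\alpha \geq 1$). Run any one of the four algorithms LLL, DeepLLL, PotLLL, $S^2$LLL on input $\mathbf{B}$ with any admissible parameter $\delta$, including the maximal parameter $\delta = 1$ (admissible means $1/4<\delta\le 1$ for LLL, DeepLLL, PotLLL, and $0<\delta\le 1$ for $S^2$LLL). Then the total number of while blocks (main loops) executed during the algorithm is at most $$(n - 1) \cdot \left( 3 \prod_{j=2}^{n-1} (2 + \sqrt{j+3}) \right)^n \alpha^{n-1},$$ which is also upper bounded by $$(n - 1) \cdot \left( \frac{ 2 }{ \sqrt{5} } + 1 \right)^{n(n-2)} \alpha^{n-1} \left( \frac{ 3 \cdot (n+2)! }{ 8 } \right)^{n/2}.$$ Moreover, as $n\to\infty$, the last quantity is at most $$\alpha^{n-1} \left( \left( \frac{ 2 }{ \sqrt{5} } + 1 \right) e^{-1/2} n^{1/2 + o(1)} \right)^{n^2},$$ where $o(1)$ denotes a quantity depending only on $n$ and tending to $0$ as $n\to\infty$. In particular, each of these algorithms always halts within finitely many steps.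
   Context: Notation. $\|\cdot\|$ and $\langle\cdot,\cdot\rangle$ are the Euclidean norm and standard inner product; all computations are exact over $\mathbb{R}$. For a basis $\mathbf{B}=[\mathbf{b}_1,\dots,\mathbf{b}_n]$ of a full-rank lattice $L=\{\sum_i v_i\mathbf{b}_i : v_i\in\mathbb{Z}\}\subset\mathbb{R}^n$, the Gram--Schmidt orthogonalization (GSO) is $\mathbf{b}_i^\ast=\mathbf{b}_i-\sum_{j<i}\mu_{ij}\mathbf{b}_j^\ast$ with $\mu_{ij}=\langle\mathbf{b}_i,\mathbf{b}_j^\ast\rangle/\|\mathbf{b}_j^\ast\|^2$ for $j<i$; $B_i=\|\mathbf{b}_i^\ast\|^2$; $\mathrm{vol}(L)=\prod_{i=1}^n\|\mathbf{b}_i^\ast\|$. Empty products equal $1$. For $i<k$, $\sigma_{i,k}(\mathbf{B})=[\mathbf{b}_1,\dots,\mathbf{b}_{i-1},\mathbf{b}_k,\mathbf{b}_i,\dots,\mathbf{b}_{k-1},\mathbf{b}_{k+1},\dots,\mathbf{b}_n]$. Put $\mathrm{Pot}(\mathbf{B})=\prod_{i=1}^n B_i^{\,n-i+1}$, $\mathrm{SS}(\mathbf{B})=\sum_{i=1}^n B_i$, and $S_{ik}=\mathrm{SS}(\mathbf{B})-\mathrm{SS}(\sigma_{i,k}(\mathbf{B}))$. Size-reduction of $\mathbf{B}$: for $i=1,\dots,n$ and, for each $i$, for $j=i-1,i-2,\dots,1$, replace $\mathbf{b}_i$ by $\mathbf{b}_i-\lfloor\mu_{ij}\rceil\mathbf{b}_j$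 (current value of $\mu_{ij}$; $\lfloor\cdot\rceil$ is rounding to a nearest integer) and update the coefficients $\mu$. After this all $|\mu_{ij}|\le 1/2$; the vectors $\mathbf{b}_i^\ast$ do not change. The algorithms. Each takes a basis $\mathbf{B}$ and a parameter $\delta$, starts with $k=2$, and, as long as $k\le n$, executes a "while block"; it halts and returns $\mathbf{B}$ when $k=n+1$. A while block first size-reduces $\mathbf{B}$ and then does the following (each pass through size-reduction and the subsequent test, ending with an increase of $k$ or a swap, is counted as one while block). A swap at $(i,k)$ means: replace $\mathbf{B}$ by $\sigma_{i,k}(\mathbf{B})$ and update the GSO. - LLL ($1/4<\delta\le1$): if $B_k\ge(\delta-\mu_{k,k-1}^2)B_{k-1}$, set $k\leftarrow k+1$; otherwise swap at $(k-1,k)$ and set $k\leftarrow\max\{k-1,2\}$. - DeepLLL ($1/4<\delta\le1$): set $C\leftarrow\|\mathbf{b}_k\|^2$. For $i=1,\dots,k-1$ in turn: if $C\ge\delta\|\mathbf{b}_i^\ast\|^2$, set $C\leftarrow C-\mu_{ki}^2\|\mathbf{b}_i^\ast\|^2$ and continue; otherwise swap at $(i,k)$, set $k\leftarrow\max\{i,2\}$ and end the block. If the for-loop is completed without a swap, set $k\leftarrow k+1$. - PotLLL ($1/4<\delta\le1$): let $i$ be the largest index in $\{1,\dots,k-1\}$ minimizing $\mathrm{Pot}(\sigma_{i,k}(\mathbf{B}))$. If $\delta\,\mathrm{Pot}(\mathbf{B})\le\mathrm{Pot}(\sigma_{i,k}(\mathbf{B}))$, set $k\leftarrow k+1$; otherwise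 swap at $(i,k)$ and set $k\leftarrow\max\{i,2\}$. - $S^2$LLL ($0<\delta\le1$): let $i$ be the largest index in $\{1,\dots,k-1\}$ maximizing $S_{ik}$. If $S_{ik}\le(1-\delta)\,\mathrm{SS}(\mathbf{B})$, set $k\leftarrow k+1$; otherwise swap at $(i,k)$ and set $k\leftarrow\max\{i,2\}$. *)

theory Defs
  imports "HOL-Analysis.Analysis"
begin

text \<open>
  A basis \<open>b\<^sub>1, \<dots>, b\<^sub>n\<close> is a function on \<open>nat\<close> of which only the values at the
  indices \<open>1, \<dots>, n\<close> matter.
\<close>

function gso :: "(nat \<Rightarrow> 'a::real_inner) \<Rightarrow> nat \<Rightarrow> 'a" where
  "gso b i = b i - (\<Sum>j\<in>{1..<i}. ((b i \<bullet> gso b j) / (norm (gso b j))\<^sup>2) *\<^sub>R gso b j)"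
  by pat_completeness auto
termination
  by (relation "Wellfounded.measure snd") auto

declare gso.simps [simp del]

definition mu :: "(nat \<Rightarrow> 'a::real_inner) \<Rightarrow> nat \<Rightarrow> nat \<Rightarrow> real" where
  "mu b i j = (b i \<bullet> gso b j) / (norm (gso b j))\<^sup>2"

definition gso_sq :: "(nat \<Rightarrow> 'a::real_inner) \<Rightarrow> nat \<Rightarrow> real" where
  "gso_sq b i = (norm (gso b i))\<^sup>2"

definition lattice_of :: "nat \<Rightarrow> (nat \<Rightarrow> 'a::real_vector) \<Rightarrow> 'a set" where
  "lattice_of n b = {\<Sum>i\<in>{1..n}. real_of_int (v i) *\<^sub>R b i | v :: nat \<Rightarrow> int. True}"

text \<open>The lattice has full rank exactly if \<open>n\<close> is the dimension of the ambient space.\<close>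

definition is_lattice_basis :: "nat \<Rightarrow> (nat \<Rightarrow> 'a::real_vector) \<Rightarrow> 'a set \<Rightarrow> bool" where
  "is_lattice_basis n b L \<longleftrightarrow>
     inj_on b {1..n} \<and> independent (b ` {1..n}) \<and> L = lattice_of n b"

text \<open>The volume of the lattice spanned by \<open>b\<^sub>1, \<dots>, b\<^sub>n\<close>, computed from this basis.\<close>

definition lattice_vol :: "nat \<Rightarrow> (nat \<Rightarrow> 'a::real_inner) \<Rightarrow> real" where
  "lattice_vol n b = (\<Prod>i\<in>{1..n}. norm (gso b i))"

definition Pot :: "nat \<Rightarrow> (nat \<Rightarrow> 'a::real_inner) \<Rightarrow> real" where
  "Pot n b = (\<Prod>i\<in>{1..n}. gso_sq b i ^ (n - i + 1))"

definition SS :: "nat \<Rightarrow> (nat \<Rightarrow> 'a::real_inner) \<Rightarrow> real" where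
  "SS n b = (\<Sum>i\<in>{1..n}. gso_sq b i)"

text \<open>\<open>b\<^sub>k\<close> is moved to position \<open>i\<close>, and \<open>b\<^sub>i, \<dots>, b\<^bsub>k-1\<^esub>\<close> move up by one position.\<close>

definition deep_insert :: "nat \<Rightarrow> nat \<Rightarrow> (nat \<Rightarrow> 'a) \<Rightarrow> nat \<Rightarrow> 'a" where
  "deep_insert i k b = (\<lambda>j. if j = i then b k else if i < j \<and> j \<le> k then b (j - 1) else b j)"

definition SS_diff :: "nat \<Rightarrow> (nat \<Rightarrow> 'a::real_inner) \<Rightarrow> nat \<Rightarrow> nat \<Rightarrow> real" where
  "SS_diff n b i k = SS n b - SS n (deep_insert i k b)"

text \<open>
  A rounding function returns some nearest integer; how ties are broken is left open.
\<close>

definition nearest_rounding :: "(real \<Rightarrow> int) \<Rightarrow> bool" where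
  "nearest_rounding rnd \<longleftrightarrow> (\<forall>x. \<bar>x - real_of_int (rnd x)\<bar> \<le> 1/2)"

definition size_reduce_vec ::
    "(real \<Rightarrow> int) \<Rightarrow> nat \<Rightarrow> (nat \<Rightarrow> 'a::real_inner) \<Rightarrow> (nat \<Rightarrow> 'a)" where
  "size_reduce_vec rnd i =
     fold (\<lambda>j b. b(i := b i - real_of_int (rnd (mu b i j)) *\<^sub>R b j)) (rev [1..<i])"

definition size_reduce ::
    "(real \<Rightarrow> int) \<Rightarrow> nat \<Rightarrow> (nat \<Rightarrow> 'a::real_inner) \<Rightarrow> (nat \<Rightarrow> 'a)" where
  "size_reduce rnd n = fold (size_reduce_vec rnd) [1..<Suc n]"

text \<open>
  The tests below are applied to a size-reduced basis.  The result is the position \<open>i\<close> for a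
  swap at \<open>(i, k)\<close>, or \<open>None\<close> if \<open>k\<close> is to be increased.
\<close>

definition lll_test :: "real \<Rightarrow> (nat \<Rightarrow> 'a::real_inner) \<Rightarrow> nat \<Rightarrow> nat option" where
  "lll_test \<delta> b k =
     (if gso_sq b k \<ge> (\<delta> - (mu b k (k - 1))\<^sup>2) * gso_sq b (k - 1) then None else Some (k - 1))"

primrec deep_loop ::
    "real \<Rightarrow> (nat \<Rightarrow> 'a::real_inner) \<Rightarrow> nat \<Rightarrow> real \<Rightarrow> nat list \<Rightarrow> nat option" where
  "deep_loop \<delta> b k C [] = None"
| "deep_loop \<delta> b k C (i # is) =
     (if C \<ge> \<delta> * (norm (gso b i))\<^sup>2
      then deep_loop \<delta> b k (C - (mu b k i)\<^sup>2 * (norm (gso b i))\<^sup>2) is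
      else Some i)"

definition deep_test :: "real \<Rightarrow> (nat \<Rightarrow> 'a::real_inner) \<Rightarrow> nat \<Rightarrow> nat option" where
  "deep_test \<delta> b k = deep_loop \<delta> b k ((norm (b k))\<^sup>2) [1..<k]"

definition pot_test :: "nat \<Rightarrow> real \<Rightarrow> (nat \<Rightarrow> 'a::real_inner) \<Rightarrow> nat \<Rightarrow> nat option" where
  "pot_test n \<delta> b k =
     (let i = Max {i. is_arg_min (\<lambda>i. Pot n (deep_insert i k b)) (\<lambda>i. i \<in> {1..k - 1}) i}
      in if \<delta> * Pot n b \<le> Pot n (deep_insert i k b) then None else Some i)"

definition s2_test :: "nat \<Rightarrow> real \<Rightarrow> (nat \<Rightarrow> 'a::real_inner) \<Rightarrow> nat \<Rightarrow> nat option" where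
  "s2_test n \<delta> b k =
     (let i = Max {i. is_arg_max (\<lambda>i. SS_diff n b i k) (\<lambda>i. i \<in> {1..k - 1}) i}
      in if SS_diff n b i k \<le> (1 - \<delta>) * SS n b then None else Some i)"

datatype lll_variant = LLL | DeepLLL | PotLLL | S2LLL

primrec swap_test ::
    "lll_variant \<Rightarrow> nat \<Rightarrow> real \<Rightarrow> (nat \<Rightarrow> 'a::real_inner) \<Rightarrow> nat \<Rightarrow> nat option" where
  "swap_test LLL n \<delta> b k = lll_test \<delta> b k"
| "swap_test DeepLLL n \<delta> b k = deep_test \<delta> b k"
| "swap_test PotLLL n \<delta> b k = pot_test n \<delta> b k"
| "swap_test S2LLL n \<delta> b k = s2_test n \<delta> b k"

primrec admissible :: "lll_variant \<Rightarrow> real \<Rightarrow> bool" where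
  "admissible LLL \<delta> \<longleftrightarrow> 1/4 < \<delta> \<and> \<delta> \<le> 1"
| "admissible DeepLLL \<delta> \<longleftrightarrow> 1/4 < \<delta> \<and> \<delta> \<le> 1"
| "admissible PotLLL \<delta> \<longleftrightarrow> 1/4 < \<delta> \<and> \<delta> \<le> 1"
| "admissible S2LLL \<delta> \<longleftrightarrow> 0 < \<delta> \<and> \<delta> \<le> 1"

definition while_block ::
    "lll_variant \<Rightarrow> (real \<Rightarrow> int) \<Rightarrow> nat \<Rightarrow> real \<Rightarrow>
     (nat \<Rightarrow> 'a::real_inner) \<times> nat \<Rightarrow> (nat \<Rightarrow> 'a) \<times> nat" where
  "while_block alg rnd n \<delta> = (\<lambda>(b, k).
     let b' = size_reduce rnd n b
     in case swap_test alg n \<delta> b' k of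
          None \<Rightarrow> (b', k + 1)
        | Some i \<Rightarrow> (deep_insert i k b', max i 2))"

text \<open>
  \<open>N\<close> is determined by the input: the loop is left after the first block that makes \<open>k\<close>
  exceed \<open>n\<close>, and no such \<open>N\<close> exists if the loop runs forever.
\<close>

definition halts_after ::
    "lll_variant \<Rightarrow> (real \<Rightarrow> int) \<Rightarrow> nat \<Rightarrow> real \<Rightarrow> (nat \<Rightarrow> 'a::real_inner) \<Rightarrow> nat \<Rightarrow> bool"
  where
  "halts_after alg rnd n \<delta> b N \<longleftrightarrow>
     (\<forall>t<N. snd ((while_block alg rnd n \<delta> ^^ t) (b, 2)) \<le> n) \<and>
     snd ((while_block alg rnd n \<delta> ^^ N) (b, 2)) = n + 1"

definition block_bound :: "nat \<Rightarrow> real \<Rightarrow> real" where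
  "block_bound n \<alpha> =
     (real n - 1) * (3 * (\<Prod>j\<in>{2..n - 1}. 2 + sqrt (real j + 3))) ^ n * \<alpha> ^ (n - 1)"

definition block_bound_fact :: "nat \<Rightarrow> real \<Rightarrow> real" where
  "block_bound_fact n \<alpha> =
     (real n - 1) * (2 / sqrt 5 + 1) ^ (n * (n - 2)) * \<alpha> ^ (n - 1)
       * (3 * fact (n + 2) / 8) powr (real n / 2)"

end

theory Submission
  imports Defs "HOL-Real_Asymp.Real_Asymp"
begin

text \<open>
  A swap at \<open>(i, k)\<close> in any of the four algorithms leaves \<open>B\<^sub>1, \<dots>, B\<^bsub>i-1\<^esub>\<close> unchanged and
  strictly decreases \<open>B\<^sub>i\<close>, even for \<open>\<delta> = 1\<close>; hence \<open>(B\<^sub>1, \<dots>, B\<^bsub>n-1\<^esub>)\<close> decreases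
  lexicographically, while size reduction does not change it. All \<open>\<parallel>b\<^sub>j\<^sup>*\<parallel>\<close> stay at most \<open>M\<close>, so
  after size reduction \<open>\<parallel>b\<^sub>j\<parallel> \<le> M \<surd>(j + 3) / 2\<close>, and the number of possible values of the tuple is
  at most the number of \<open>(b\<^sub>1, \<dots>, b\<^bsub>n-1\<^esub>) \<in> L\<^bsup>n-1\<^esup>\<close> with these bounds. A ball of radius \<open>R\<close>
  contains at most \<open>\<Prod>\<^sub>l (2R / \<parallel>b\<^sub>l\<^sup>*\<parallel> + 1)\<close> lattice vectors. Finally, a swap lowers \<open>k\<close> by at most
  \<open>n - 2\<close>, so each tuple accounts for at most \<open>n - 1\<close> blocks.

  For PotLLL and \<open>S\<^sup>2\<close>LLL, \<open>\<sigma>\<^bsub>i,k\<^esub>(B)\<close> arises from \<open>\<sigma>\<^bsub>i+1,k\<^esub>(B)\<close> by swapping the neighbours \<open>i, i+1\<close>.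
  As \<open>i\<close> is the largest optimal index, this swap strictly improves the potential, which for a swap of
  neighbours forces \<open>B\<^sub>i\<close> to decrease.
\<close>

section \<open>Gram--Schmidt orthogonalization\<close>

lemma gso_mu: "gso b i = b i - (\<Sum>j\<in>{1..<i}. mu b i j *\<^sub>R gso b j)"
  by (subst gso.simps) (simp add: mu_def)

lemma gso_cong:
  assumes "\<And>l. 1 \<le> l \<Longrightarrow> l \<le> j \<Longrightarrow> b l = c l" and "1 \<le> j"
  shows "gso b j = gso c j"
  using assms
proof (induction j rule: less_induct)
  case (less j)
  have "gso b l = gso c l" if "l \<in> {1..<j}" for l
    using less that by auto
  with less.prems show ?case
    by (simp add: gso.simps[of b j] gso.simps[of c j])
qed

text \<open>The two memberships are proved by one simultaneous induction: the difference is a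
  combination of earlier \<open>gso b l\<close>, which lie in the span by the second claim, and the
  second claim for \<open>i\<close> follows from the first.\<close>

lemma diff_gso_in_span: "b i - gso b i \<in> span (b ` {1..<i})"
  and gso_in_span: "1 \<le> i \<Longrightarrow> i < j \<Longrightarrow> gso b i \<in> span (b ` {1..<j})"
proof (induction i arbitrary: j rule: less_induct)
  case (less i)
  show 1: "b i - gso b i \<in> span (b ` {1..<i})"
  proof -
    have "(\<Sum>l\<in>{1..<i}. mu b i l *\<^sub>R gso b l) \<in> span (b ` {1..<i})"
      by (intro span_sum span_scale less(2)) auto
    then show ?thesis by (subst gso_mu) simp
  qed
  show "gso b i \<in> span (b ` {1..<j})" if "1 \<le> i" "i < j" for j
  proof -
    have "span (b ` {1..<i}) \<subseteq> span (b ` {1..<j})"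
      using that by (intro span_mono image_mono) auto
    with 1 have "b i - gso b i \<in> span (b ` {1..<j})" by auto
    moreover have "b i \<in> span (b ` {1..<j})" using that by (auto intro: span_base)
    ultimately have "b i - (b i - gso b i) \<in> span (b ` {1..<j})" using span_diff by blast
    then show ?thesis by simp
  qed
qed

lemma gso_orthogonal:
  assumes "1 \<le> j" "j < i"
  shows "gso b i \<bullet> gso b j = 0"
  using assms
proof (induction i arbitrary: j rule: less_induct)
  case (less i)
  have orth: "gso b l \<bullet> gso b j = 0" if "l \<in> {1..<i}" "l \<noteq> j" for l
  proof (cases "l < j")
    case True
    then show ?thesis using less.IH[of j l] less.prems that by (simp add: inner_commute)
  next
    case False
    then show ?thesis using less.IH[of l j] less.prems that by simp
  qed
  have "(\<Sum>l\<in>{1..<i}. mu b i l *\<^sub>R gso b l) \<bullet> gso b j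
      = (\<Sum>l\<in>{1..<i}. if l = j then mu b i j * (gso b j \<bullet> gso b j) else 0)"
    unfolding inner_sum_left by (rule sum.cong) (use orth in auto)
  also have "\<dots> = mu b i j * (gso b j \<bullet> gso b j)"
    using less.prems by simp
  \<comment> \<open>If \<open>gso b j = 0\<close>, both sides vanish; otherwise the denominator of
    \<open>mu b i j\<close> cancels.\<close>
  also have "\<dots> = b i \<bullet> gso b j"
    by (cases "gso b j = 0") (simp_all add: mu_def power2_norm_eq_inner)
  finally show ?case
    by (subst gso_mu) (simp add: inner_diff_left)
qed

lemma span_inner_zero:
  fixes w :: "'a::real_inner"
  assumes "x \<in> span S" and "\<And>s. s \<in> S \<Longrightarrow> w \<bullet> s = 0"
  shows "w \<bullet> x = 0"
  using assms by (induction rule: span_induct_alt) (auto simp: inner_add_right)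

lemma gso_orthogonal_vec:
  assumes "1 \<le> j" "j < i"
  shows "gso b i \<bullet> b j = 0"
proof -
  have "b j = gso b j + (\<Sum>l\<in>{1..<j}. mu b j l *\<^sub>R gso b l)"
    by (subst gso_mu) simp
  then have "gso b i \<bullet> b j = gso b i \<bullet> gso b j + (\<Sum>l\<in>{1..<j}. mu b j l * (gso b i \<bullet> gso b l))"
    by (metis (no_types, lifting) inner_add_right inner_scaleR_right inner_sum_right sum.cong)
  also have "\<dots> = 0"
    using assms by (auto simp: gso_orthogonal)
  finally show ?thesis .
qed

text \<open>Two candidates differ by a vector that lies in the span of the earlier vectors and is
  orthogonal to it, hence by 0. Every later computation of a Gram-Schmidt vector of a modified basis
  goes through this characterization.\<close>

lemma gso_unique:
  assumes "b i - w \<in> span (b ` {1..<i})" and "\<And>l. 1 \<le> l \<Longrightarrow> l < i \<Longrightarrow> w \<bullet> b l = 0"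
  shows "gso b i = w"
proof -
  have "(b i - w) - (b i - gso b i) \<in> span (b ` {1..<i})"
    by (rule span_diff[OF assms(1) diff_gso_in_span])
  then have d: "gso b i - w \<in> span (b ` {1..<i})" by simp
  have "(gso b i - w) \<bullet> (gso b i - w) = 0"
    by (rule span_inner_zero[OF d]) (auto simp: inner_diff_left assms(2) gso_orthogonal_vec)
  then show ?thesis by simp
qed

lemma norm_sq_gso:
  assumes "1 \<le> i"
  shows "(norm (b i))\<^sup>2 = gso_sq b i + (\<Sum>j\<in>{1..<i}. (mu b i j)\<^sup>2 * gso_sq b j)"
proof -
  let ?p = "\<lambda>j. (if j = i then 1 else mu b i j) *\<^sub>R gso b j"
  have ins: "{1..i} = insert i {1..<i}" using assms by auto
  have "b i = (\<Sum>j\<in>{1..i}. ?p j)"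
    unfolding ins by (simp add: gso_mu[of b i])
  moreover have "(norm (\<Sum>j\<in>{1..i}. ?p j))\<^sup>2 = (\<Sum>j\<in>{1..i}. (norm (?p j))\<^sup>2)"
  proof (rule norm_sum_Pythagorean)
    have "gso b j \<bullet> gso b l = 0" if "j \<noteq> l" "1 \<le> j" "1 \<le> l" for j l
      using that gso_orthogonal[of j l b] gso_orthogonal[of l j b]
      by (cases "j < l") (auto simp: inner_commute)
    then show "pairwise (\<lambda>j l. orthogonal (?p j) (?p l)) {1..i}"
      by (simp add: pairwise_def orthogonal_def)
  qed simp
  moreover have "\<dots> = gso_sq b i + (\<Sum>j\<in>{1..<i}. (mu b i j)\<^sup>2 * gso_sq b j)"
    unfolding ins by (simp add: gso_sq_def power_mult_distrib)
  ultimately show ?thesis by simp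
qed

lemma gso_nonzero_if_independent:
  assumes "inj_on b {1..n}" "independent (b ` {1..n})" "1 \<le> j" "j \<le> n"
  shows "gso b j \<noteq> 0"
proof
  assume "gso b j = 0"
  with diff_gso_in_span[of b j] have "b j \<in> span (b ` {1..<j})" by simp
  moreover have "b ` {1..<j} \<subseteq> b ` {1..n} - {b j}"
    using assms(3,4) inj_onD[OF assms(1)] by force
  ultimately have "b j \<in> span (b ` {1..n} - {b j})"
    using span_mono by blast
  with assms show False by (auto simp: dependent_def)
qed

section \<open>Size reduction\<close>

text \<open>At \<open>i\<close> the vector changes only by an element of the span of its
  predecessors, so \<open>gso_unique\<close> applies. At every other index the recursion sees the
  same vector and, by induction, the same earlier Gram-Schmidt vectors.\<close>

lemma gso_subtract:
  assumes "1 \<le> j" "j < i"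
  shows "gso (b(i := b i - c *\<^sub>R b j)) l = gso b l"
proof (induction l rule: less_induct)
  case (less l)
  let ?b = "b(i := b i - c *\<^sub>R b j)"
  show ?case
  proof (cases "l = i")
    case False
    then show ?thesis
      by (subst (1 2) gso.simps) (simp add: less)
  next
    case True
    have img: "?b ` {1..<i} = b ` {1..<i}" by (rule image_cong) auto
    have "b j \<in> span (b ` {1..<i})" using assms by (auto intro: span_base)
    then have "(b i - gso b i) - c *\<^sub>R b j \<in> span (b ` {1..<i})"
      by (intro span_diff span_scale diff_gso_in_span)
    then have "?b i - gso b i \<in> span (?b ` {1..<i})"
      unfolding img by (simp add: algebra_simps)
    then show ?thesis unfolding True
      by (rule gso_unique) (auto simp: gso_orthogonal_vec)
  qed
qed

lemma gso_inner_self: "gso b j \<bullet> b j = gso_sq b j"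
proof -
  have "gso b j \<bullet> (b j - gso b j) = 0"
    by (rule span_inner_zero[OF diff_gso_in_span]) (auto simp: gso_orthogonal_vec)
  then show ?thesis by (simp add: inner_diff_right gso_sq_def power2_norm_eq_inner)
qed

lemma mu_self: "gso b j \<noteq> 0 \<Longrightarrow> mu b j j = 1"
  by (simp add: mu_def inner_commute[of "b j"] gso_inner_self gso_sq_def)

lemma mu_above: "1 \<le> j \<Longrightarrow> j < l \<Longrightarrow> mu b j l = 0"
  by (simp add: mu_def inner_commute[of "b j"] gso_orthogonal_vec)

lemma mu_subtract:
  assumes "1 \<le> j" "j < i"
  shows "mu (b(i := b i - c *\<^sub>R b j)) i l = mu b i l - c * mu b j l"
  by (simp add: mu_def gso_subtract[OF assms] inner_diff_left diff_divide_distrib)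

text \<open>The bound \<open>m\<close> is the progress of the inner loop, which still has to treat
  \<open>m - 1\<close> down to \<open>1\<close>. The descending order matters: subtracting a
  multiple of \<open>b j\<close> leaves \<open>mu b i l\<close> alone for \<open>l > j\<close>,
  because \<open>mu b j l = 0\<close> there, so coefficients already made small stay small.\<close>

lemma size_reduce_row:
  assumes "nearest_rounding rnd" "m \<le> i" "1 \<le> i"
    and "\<And>l. 1 \<le> l \<Longrightarrow> l < i \<Longrightarrow> gso b l \<noteq> 0"
    and "\<And>l. 1 \<le> l \<Longrightarrow> l \<le> i \<Longrightarrow> b l \<in> L"
    and "\<And>x y c. x \<in> L \<Longrightarrow> y \<in> L \<Longrightarrow> x - real_of_int c *\<^sub>R y \<in> L"
  defines "b' \<equiv> fold (\<lambda>j b. b(i := b i - real_of_int (rnd (mu b i j)) *\<^sub>R b j)) (rev [1..<m]) b"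
  shows "gso b' = gso b \<and> (\<forall>l. l \<noteq> i \<longrightarrow> b' l = b l) \<and> b' i \<in> L \<and>
     (\<forall>l\<ge>m. mu b' i l = mu b i l) \<and> (\<forall>l. 1 \<le> l \<and> l < m \<longrightarrow> \<bar>mu b' i l\<bar> \<le> 1/2)"
  unfolding b'_def using assms(2,4,5)
proof (induction m arbitrary: b)
  case 0
  then show ?case using assms(3) by simp
next
  case (Suc m)
  show ?case
  proof (cases "m = 0")
    case True
    then show ?thesis using Suc.prems assms(3) by simp
  next
    case False
    define c where "c = b(i := b i - real_of_int (rnd (mu b i m)) *\<^sub>R b m)"
    have m: "1 \<le> m" "m < i" using False Suc.prems by auto
    have g: "gso c = gso b" unfolding c_def by (rule ext) (rule gso_subtract[OF m])
    have muc: "mu c i l = mu b i l - real_of_int (rnd (mu b i m)) * mu b m l" for l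
      unfolding c_def by (rule mu_subtract[OF m])
    have cL: "c l \<in> L" if "1 \<le> l" "l \<le> i" for l
      unfolding c_def using Suc.prems(3) that m assms(6) by auto
    let ?f = "fold (\<lambda>j b. b(i := b i - real_of_int (rnd (mu b i j)) *\<^sub>R b j)) (rev [1..<m]) c"
    have IH: "gso ?f = gso c \<and> (\<forall>l. l \<noteq> i \<longrightarrow> ?f l = c l) \<and> ?f i \<in> L \<and>
     (\<forall>l\<ge>m. mu ?f i l = mu c i l) \<and> (\<forall>l. 1 \<le> l \<and> l < m \<longrightarrow> \<bar>mu ?f i l\<bar> \<le> 1/2)"
      by (rule Suc.IH) (use Suc.prems cL g in auto)
    have "rev [1..<Suc m] = m # rev [1..<m]" using m by simp
    then have f: "fold (\<lambda>j b. b(i := b i - real_of_int (rnd (mu b i j)) *\<^sub>R b j)) (rev [1..<Suc m]) b = ?f"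
      by (simp add: c_def)
    \<comment> \<open>Since \<open>mu b m m = 1\<close>, the new coefficient is exactly the rounding
      error of the old one.\<close>
    have red: "\<bar>mu c i m\<bar> \<le> 1/2"
      using assms(1) muc[of m] mu_self[of b m] Suc.prems(2)[of m] m
      by (simp add: nearest_rounding_def)
    have "mu c i l = mu b i l" if "l \<ge> Suc m" for l
      using muc[of l] mu_above[of m l b] that m by simp
    with IH g red show ?thesis
      unfolding f by (auto simp: c_def less_Suc_eq)
  qed
qed

text \<open>Treating row \<open>Suc n\<close> changes neither the earlier vectors nor any
  Gram-Schmidt vector, so the earlier coefficients remain reduced. The clause on
  \<open>l > n\<close> carries the induction: the next row starts from its original vector, which
  lies in \<open>L\<close>.\<close>

lemma size_reduce_correct:
  assumes "nearest_rounding rnd"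
    and "\<And>l. 1 \<le> l \<Longrightarrow> l \<le> n \<Longrightarrow> gso b l \<noteq> 0"
    and "\<And>l. 1 \<le> l \<Longrightarrow> l \<le> n \<Longrightarrow> b l \<in> L"
    and "\<And>x y c. x \<in> L \<Longrightarrow> y \<in> L \<Longrightarrow> x - real_of_int c *\<^sub>R y \<in> L"
  shows "gso (size_reduce rnd n b) = gso b \<and>
     (\<forall>l. 1 \<le> l \<and> l \<le> n \<longrightarrow> size_reduce rnd n b l \<in> L) \<and>
     (\<forall>l. l > n \<longrightarrow> size_reduce rnd n b l = b l) \<and>
     (\<forall>i j. 1 \<le> j \<and> j < i \<and> i \<le> n \<longrightarrow> \<bar>mu (size_reduce rnd n b) i j\<bar> \<le> 1/2)"
  using assms(2,3)
proof (induction n)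
  case 0
  then show ?case by (simp add: size_reduce_def)
next
  case (Suc n)
  define c where "c = size_reduce rnd n b"
  define d where "d = size_reduce rnd (Suc n) b"
  have IH: "gso c = gso b" "\<And>l. 1 \<le> l \<Longrightarrow> l \<le> n \<Longrightarrow> c l \<in> L" "\<And>l. l > n \<Longrightarrow> c l = b l"
     "\<And>i j. 1 \<le> j \<Longrightarrow> j < i \<Longrightarrow> i \<le> n \<Longrightarrow> \<bar>mu c i j\<bar> \<le> 1/2"
    using Suc unfolding c_def by auto
  have dc: "d = size_reduce_vec rnd (Suc n) c"
    by (simp add: d_def c_def size_reduce_def)
  have cL: "c l \<in> L" if "1 \<le> l" "l \<le> Suc n" for l
    using IH(2)[of l] IH(3)[of l] Suc.prems(2)[of l] that by (cases "l = Suc n") auto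
  have D: "gso d = gso c" "\<And>l. l \<noteq> Suc n \<Longrightarrow> d l = c l" "d (Suc n) \<in> L"
     "\<And>l. 1 \<le> l \<Longrightarrow> l < Suc n \<Longrightarrow> \<bar>mu d (Suc n) l\<bar> \<le> 1/2"
    using size_reduce_row[OF assms(1), of "Suc n" "Suc n" c L] cL assms(4) IH(1) Suc.prems(1)
    unfolding dc size_reduce_vec_def by auto
  have "mu d i j = mu c i j" if "i \<noteq> Suc n" for i j
    using that D(1,2) by (simp add: mu_def)
  moreover have "d l \<in> L" if "1 \<le> l" "l \<le> Suc n" for l
    using D(2)[of l] D(3) cL[of l] that by (cases "l = Suc n") auto
  ultimately show ?case
    unfolding d_def[symmetric] using D IH by (auto simp: le_Suc_eq)
qed

section \<open>Deep insertions\<close>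

lemma deep_insert_same [simp]: "deep_insert k k b = b"
  by (auto simp: deep_insert_def)

text \<open>Breaks a deep insertion into exchanges of neighbours, which move the inserted vector
  down one place at a time.\<close>

lemma deep_insert_step:
  "i < k \<Longrightarrow> deep_insert i k b = deep_insert i (Suc i) (deep_insert (Suc i) k b)"
  by (rule ext) (auto simp: deep_insert_def)

lemma gso_deep_insert_below:
  "1 \<le> j \<Longrightarrow> j < i \<Longrightarrow> gso (deep_insert i k b) j = gso b j"
  by (rule gso_cong) (auto simp: deep_insert_def)

section \<open>Exchange of two neighbouring basis vectors\<close>

context
  fixes b c :: "nat \<Rightarrow> 'a::real_inner" and i :: nat
  assumes i: "1 \<le> i" and c: "c = deep_insert i (Suc i) b"
begin

private lemma c_simps: "c i = b (Suc i)" "c (Suc i) = b i" "l \<noteq> i \<Longrightarrow> l \<noteq> Suc i \<Longrightarrow> c l = b l"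
  by (auto simp: c deep_insert_def)

private lemma image_below: "c ` {1..<i} = b ` {1..<i}"
  by (rule image_cong) (auto simp: c_simps)

text \<open>For \<open>j > Suc i\<close> the vectors before \<open>j\<close> are merely permuted, so
  they span the same space, and the vector at \<open>j\<close> is the same.\<close>

lemma gso_adjacent_swap_other:
  assumes "1 \<le> j" "j \<noteq> i" "j \<noteq> Suc i"
  shows "gso c j = gso b j"
proof (cases "j < i")
  case True
  then show ?thesis using assms by (simp add: c gso_deep_insert_below)
next
  case False
  then have j: "Suc i < j" using assms by simp
  have "c l \<in> b ` {1..<j} \<and> b l \<in> c ` {1..<j}" if "l \<in> {1..<j}" for l
  proof -
    consider "l = i" | "l = Suc i" | "l \<noteq> i" "l \<noteq> Suc i" by auto
    then show ?thesis
    proof cases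
      case 1
      then show ?thesis using i j c_simps(1,2)
        by (intro conjI image_eqI[where x = "Suc i"]) auto
    next
      case 2
      then show ?thesis using i j c_simps(1,2)
        by (intro conjI image_eqI[where x = i]) auto
    next
      case 3
      then show ?thesis using c_simps(3)[of l] that
        by (intro conjI image_eqI[where x = l]) auto
    qed
  qed
  then have img: "c ` {1..<j} = b ` {1..<j}" and mem: "\<And>l. l \<in> {1..<j} \<Longrightarrow> c l \<in> b ` {1..<j}"
    by blast+
  show ?thesis
  proof (rule gso_unique)
    show "c j - gso b j \<in> span (c ` {1..<j})"
      unfolding img using diff_gso_in_span[of b j] c_simps(3)[of j] assms by simp
    show "gso b j \<bullet> c l = 0" if "1 \<le> l" "l < j" for l
      using mem[of l] that by (auto simp: gso_orthogonal_vec)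
  qed
qed

text \<open>The vector \<open>b (Suc i)\<close> is now projected away from the first
  \<open>i - 1\<close> vectors only and therefore keeps its component along
  \<open>gso b i\<close>.\<close>

lemma gso_adjacent_swap_first: "gso c i = gso b (Suc i) + mu b (Suc i) i *\<^sub>R gso b i"
proof (rule gso_unique)
  have "{1..<Suc i} = insert i {1..<i}" using i by auto
  then have "c i - (gso b (Suc i) + mu b (Suc i) i *\<^sub>R gso b i)
      = (\<Sum>j\<in>{1..<i}. mu b (Suc i) j *\<^sub>R gso b j)"
    by (simp add: c_simps(1) gso_mu[of b "Suc i"])
  also have "\<dots> \<in> span (b ` {1..<i})"
    by (intro span_sum span_scale gso_in_span) auto
  finally show "c i - (gso b (Suc i) + mu b (Suc i) i *\<^sub>R gso b i) \<in> span (c ` {1..<i})"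
    unfolding image_below .
  show "(gso b (Suc i) + mu b (Suc i) i *\<^sub>R gso b i) \<bullet> c l = 0" if "1 \<le> l" "l < i" for l
    using that by (simp add: c_simps(3) inner_add_left gso_orthogonal_vec)
qed

lemma gso_sq_adjacent_swap_first:
  "gso_sq c i = gso_sq b (Suc i) + (mu b (Suc i) i)\<^sup>2 * gso_sq b i"
proof -
  have "gso b (Suc i) \<bullet> gso b i = 0" using i by (simp add: gso_orthogonal)
  then show ?thesis
    unfolding gso_sq_def gso_adjacent_swap_first power2_norm_eq_inner
    by (simp add: inner_add_left inner_add_right inner_commute[of "gso b i" "gso b (Suc i)"]
        power2_eq_square[of "mu b (Suc i) i"])
qed

text \<open>The product is the Gram determinant of the two vectors projected away from the first
  \<open>i - 1\<close>, which does not depend on their order. The proof computes the new vector at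
  \<open>Suc i\<close> explicitly.\<close>

lemma gso_sq_adjacent_swap_prod:
  assumes nz: "gso b (Suc i) \<noteq> 0"
  shows "gso_sq c i * gso_sq c (Suc i) = gso_sq b i * gso_sq b (Suc i)"
proof -
  define m x x' u u' where "m = mu b (Suc i) i" and "x = gso_sq b i" and "x' = gso_sq c i"
    and "u = gso b i" and "u' = gso c i"
  \<comment> \<open>This is \<open>u\<close> minus its projection onto \<open>u'\<close>: the inner
    product of \<open>u\<close> and \<open>u'\<close> will be \<open>m * x\<close>, and the squared
    norm of \<open>u'\<close> is \<open>x'\<close>.\<close>
  define v where "v = u - (m * x / x') *\<^sub>R u'"
  have x'_eq: "x' = gso_sq b (Suc i) + m\<^sup>2 * x"
    by (simp add: x'_def m_def x_def gso_sq_adjacent_swap_first)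
  have "x' > 0"
    unfolding x'_eq x_def gso_sq_def using nz by (intro add_pos_nonneg) auto
  have "u \<bullet> b (Suc i) = m * x"
    by (cases "gso b i = 0") (simp_all add: u_def m_def x_def mu_def gso_sq_def inner_commute)
  moreover have "u \<bullet> gso b (Suc i) = 0"
    unfolding u_def using i by (simp add: inner_commute[of "gso b i"] gso_orthogonal)
  then have uu': "u \<bullet> u' = m * x"
    by (simp add: u'_def gso_adjacent_swap_first inner_add_right m_def x_def gso_sq_def u_def
        power2_norm_eq_inner)
  moreover have "u' \<bullet> b (Suc i) = x'"
    using gso_inner_self[of c i] by (simp add: u'_def x'_def c_simps)
  ultimately have v_orth: "v \<bullet> b (Suc i) = 0"
    using \<open>x' > 0\<close> by (simp add: v_def inner_diff_left)
  have "gso c (Suc i) = v"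
  proof (rule gso_unique)
    have "span (b ` {1..<i}) \<subseteq> span (c ` {1..<Suc i})"
      unfolding image_below[symmetric] by (intro span_mono image_mono) auto
    then have "b i - u \<in> span (c ` {1..<Suc i})"
      using diff_gso_in_span[of b i] by (auto simp: u_def)
    moreover have "u' \<in> span (c ` {1..<Suc i})"
      unfolding u'_def using i by (intro gso_in_span) auto
    ultimately have "(b i - u) + (m * x / x') *\<^sub>R u' \<in> span (c ` {1..<Suc i})"
      by (intro span_add span_scale)
    then show "c (Suc i) - v \<in> span (c ` {1..<Suc i})"
      by (simp add: c_simps v_def algebra_simps)
    show "v \<bullet> c l = 0" if "1 \<le> l" "l < Suc i" for l
    proof (cases "l = i")
      case True
      then show ?thesis using v_orth by (simp add: c_simps)
    next
      case False
      then have "u \<bullet> b l = 0" "u' \<bullet> c l = 0"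
        using that by (auto simp: u_def u'_def gso_orthogonal_vec)
      then show ?thesis using False that by (simp add: c_simps v_def inner_diff_left)
    qed
  qed
  then have "gso_sq c (Suc i) = v \<bullet> v" by (simp add: gso_sq_def power2_norm_eq_inner)
  also have "\<dots> = u \<bullet> u - 2 * (m * x / x') * (u \<bullet> u') + (m * x / x')\<^sup>2 * (u' \<bullet> u')"
    by (simp add: v_def inner_diff inner_commute[of u' u] power2_eq_square right_diff_distrib)
  also have "\<dots> = x - 2 * (m * x / x') * (m * x) + (m * x / x')\<^sup>2 * x'"
    unfolding uu' by (simp add: x_def x'_def u_def u'_def gso_sq_def power2_norm_eq_inner)
  finally have "x' * gso_sq c (Suc i) = x * (x' - m\<^sup>2 * x)"
    using \<open>x' > 0\<close> by (simp add: field_simps power2_eq_square)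
  moreover have "x' - m\<^sup>2 * x = gso_sq b (Suc i)" by (simp add: x'_eq)
  ultimately show ?thesis by (simp add: x'_def x_def)
qed

end

lemma gso_sq_pos_iff: "gso_sq b j > 0 \<longleftrightarrow> gso b j \<noteq> 0"
  by (simp add: gso_sq_def)

lemma gso_adjacent_swap_nonzero:
  assumes "1 \<le> i" "Suc i \<le> n" "\<And>j. 1 \<le> j \<Longrightarrow> j \<le> n \<Longrightarrow> gso b j \<noteq> 0" "1 \<le> j" "j \<le> n"
  shows "gso (deep_insert i (Suc i) b) j \<noteq> 0"
proof -
  let ?c = "deep_insert i (Suc i) b"
  have "gso_sq ?c i * gso_sq ?c (Suc i) > 0"
    using gso_sq_adjacent_swap_prod[OF assms(1) refl, of b] assms
    by (simp add: gso_sq_pos_iff)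
  then have "gso ?c i \<noteq> 0" "gso ?c (Suc i) \<noteq> 0" by (auto simp: gso_sq_def)
  then show ?thesis
    using gso_adjacent_swap_other[OF assms(1) refl assms(4), of b] assms by metis
qed

text \<open>Descending induction from \<open>i = k\<close>, one exchange per step. The exchange
  leaves at \<open>Suc i\<close> at most the old value at \<open>i\<close>, since the product of the
  two values is preserved and the first factor becomes at least the old value at
  \<open>Suc i\<close>. The current position of the inserted vector is exempt from the bound,
  because its value can grow on the way down.\<close>

lemma gso_deep_insert_bounds:
  assumes "i \<le> k" "1 \<le> i" "k \<le> n"
    and nz: "\<And>j. 1 \<le> j \<Longrightarrow> j \<le> n \<Longrightarrow> gso b j \<noteq> 0"
    and le: "\<And>j. 1 \<le> j \<Longrightarrow> j \<le> n \<Longrightarrow> gso_sq b j \<le> M"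
  shows "(\<forall>j. 1 \<le> j \<and> j \<le> n \<longrightarrow> gso (deep_insert i k b) j \<noteq> 0) \<and>
     (\<forall>j. 1 \<le> j \<and> j \<le> n \<and> j \<noteq> i \<longrightarrow> gso_sq (deep_insert i k b) j \<le> M)"
  using assms(1,2)
proof (induction i rule: inc_induct)
  case base
  then show ?case using nz le by simp
next
  case (step i)
  define c where "c = deep_insert (Suc i) k b"
  have d: "deep_insert i k b = deep_insert i (Suc i) c"
    unfolding c_def using step by (intro deep_insert_step) simp
  let ?d = "deep_insert i (Suc i) c"
  have i: "1 \<le> i" "Suc i \<le> n" using step assms(3) by auto
  have cnz: "gso c j \<noteq> 0" if "1 \<le> j" "j \<le> n" for j
    using step.IH that by (simp add: c_def)
  have cle: "gso_sq c j \<le> M" if "1 \<le> j" "j \<le> n" "j \<noteq> Suc i" for j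
    using step.IH that by (simp add: c_def)
  have first: "gso_sq ?d i \<ge> gso_sq c (Suc i)"
    using gso_sq_adjacent_swap_first[OF i(1) refl, of c] by (simp add: gso_sq_def)
  have pos: "gso_sq c (Suc i) > 0" using cnz i by (simp add: gso_sq_pos_iff)
  have "gso_sq c (Suc i) * gso_sq ?d (Suc i) \<le> gso_sq ?d i * gso_sq ?d (Suc i)"
    using first by (rule mult_right_mono) (simp add: gso_sq_def)
  also have "\<dots> = gso_sq c (Suc i) * gso_sq c i"
    using gso_sq_adjacent_swap_prod[OF i(1) refl cnz] i by simp
  finally have "gso_sq ?d (Suc i) \<le> gso_sq c i" using pos by simp
  also have "\<dots> \<le> M" using cle i by simp
  finally have "gso_sq ?d (Suc i) \<le> M" .
  moreover have "gso_sq ?d j \<le> M" if "1 \<le> j" "j \<le> n" "j \<noteq> i" "j \<noteq> Suc i" for j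
    using gso_adjacent_swap_other[OF i(1) refl, of j c] cle[of j] that by (simp add: gso_sq_def)
  ultimately show ?case
    unfolding d using gso_adjacent_swap_nonzero[OF i cnz] by metis
qed

text \<open>The exponents \<open>n - i + 1\<close> and \<open>n - i\<close> let the two affected
  factors be written as \<open>gso_sq b i\<close> times a power of the invariant product. The
  potential thus changes by the same factor as \<open>gso_sq b i\<close>.\<close>

lemma Pot_adjacent_swap_less:
  assumes "1 \<le> i" "Suc i \<le> n" "\<And>j. 1 \<le> j \<Longrightarrow> j \<le> n \<Longrightarrow> gso b j \<noteq> 0"
    and less: "Pot n (deep_insert i (Suc i) b) < Pot n b"
  shows "gso_sq (deep_insert i (Suc i) b) i < gso_sq b i"
proof -
  let ?c = "deep_insert i (Suc i) b"
  define P where "P = (\<Prod>j\<in>{1..n} - {i, Suc i}. gso_sq b j ^ (n - j + 1))"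
  have ins: "{1..n} = insert i (insert (Suc i) ({1..n} - {i, Suc i}))" using assms by auto
  have expand: "Pot n d = gso_sq d i * (gso_sq d i * gso_sq d (Suc i)) ^ (n - i) * P"
    if "\<And>j. 1 \<le> j \<Longrightarrow> j \<le> n \<Longrightarrow> j \<noteq> i \<Longrightarrow> j \<noteq> Suc i \<Longrightarrow> gso_sq d j = gso_sq b j" for d :: "nat \<Rightarrow> 'a"
  proof -
    have "(\<Prod>j\<in>{1..n} - {i, Suc i}. gso_sq d j ^ (n - j + 1)) = P"
      unfolding P_def using that by (intro prod.cong) auto
    moreover have "n - Suc i + 1 = n - i" using assms by simp
    moreover have "Pot n d = gso_sq d i ^ (n - i + 1) * (gso_sq d (Suc i) ^ (n - Suc i + 1)
        * (\<Prod>j\<in>{1..n} - {i, Suc i}. gso_sq d j ^ (n - j + 1)))"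
      unfolding Pot_def by (subst ins) simp
    ultimately show ?thesis by (simp only: power_add power_one_right power_mult_distrib mult_ac)
  qed
  have "P > 0"
    unfolding P_def using assms by (intro prod_pos) (auto simp: gso_sq_def)
  define q where "q = (gso_sq b i * gso_sq b (Suc i)) ^ (n - i)"
  have "q > 0" unfolding q_def using assms by (simp add: gso_sq_pos_iff)
  have "Pot n b = gso_sq b i * q * P" using expand[of b] by (simp add: q_def)
  moreover have "Pot n ?c = gso_sq ?c i * q * P"
    using expand[of ?c] gso_sq_adjacent_swap_prod[OF assms(1) refl, of b] assms
      gso_adjacent_swap_other[OF assms(1) refl, of _ b] by (simp add: q_def gso_sq_def)
  ultimately show ?thesis using less \<open>P > 0\<close> \<open>q > 0\<close> by simp
qed

text \<open>Write \<open>x, y\<close> for the old and \<open>x', y'\<close> for the new pair. From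
  \<open>x' * y' = x * y\<close> one gets
  \<open>x' * (x' + y' - x - y) = (x' - x) * (x' - y)\<close>. As \<open>y \<le> x'\<close> always
  holds, \<open>x \<le> x'\<close> would make this nonnegative and the sum could not drop.\<close>

lemma SS_adjacent_swap_less:
  assumes "1 \<le> i" "Suc i \<le> n" "\<And>j. 1 \<le> j \<Longrightarrow> j \<le> n \<Longrightarrow> gso b j \<noteq> 0"
    and less: "SS n (deep_insert i (Suc i) b) < SS n b"
  shows "gso_sq (deep_insert i (Suc i) b) i < gso_sq b i"
proof (rule ccontr)
  let ?c = "deep_insert i (Suc i) b"
  define x y x' y' where "x = gso_sq b i" and "y = gso_sq b (Suc i)"
    and "x' = gso_sq ?c i" and "y' = gso_sq ?c (Suc i)"
  note defs = x_def y_def x'_def y'_def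
  assume "\<not> gso_sq ?c i < gso_sq b i"
  then have "x \<le> x'" by (simp add: defs)
  have prod: "x' * y' = x * y"
    using gso_sq_adjacent_swap_prod[OF assms(1) refl, of b] assms by (simp add: defs)
  have "y \<le> x'"
    using gso_sq_adjacent_swap_first[OF assms(1) refl, of b] by (simp add: defs gso_sq_def)
  have "x > 0" "y > 0" unfolding defs using assms by (simp_all add: gso_sq_pos_iff)
  have ins: "{1..n} = insert i (insert (Suc i) ({1..n} - {i, Suc i}))" using assms by auto
  have "(\<Sum>j\<in>{1..n} - {i, Suc i}. gso_sq ?c j) = (\<Sum>j\<in>{1..n} - {i, Suc i}. gso_sq b j)"
    using gso_adjacent_swap_other[OF assms(1) refl, of _ b]
    by (intro sum.cong) (auto simp: gso_sq_def)
  with less have "x' + y' < x + y"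
    unfolding SS_def defs by (subst (asm) (1 2) ins) simp
  then have "x' * (x' + y') < x' * (x + y)"
    using \<open>x > 0\<close> \<open>x \<le> x'\<close> by simp
  then have "(x' - x) * (x' - y) < 0" using prod by (simp add: algebra_simps)
  moreover have "(x' - x) * (x' - y) \<ge> 0" using \<open>x \<le> x'\<close> \<open>y \<le> x'\<close> by simp
  ultimately show False by simp
qed

section \<open>The four swap tests\<close>

text \<open>Pythagoras for the inserted vector, whose \<open>i - 1\<close> predecessors are
  unchanged. The right-hand side is the value of \<open>C\<close> when the DeepLLL loop reaches
  \<open>i\<close>.\<close>

lemma gso_sq_deep_insert_at:
  assumes "1 \<le> i"
  shows "gso_sq (deep_insert i k b) i = (norm (b k))\<^sup>2 - (\<Sum>j\<in>{1..<i}. (mu b k j)\<^sup>2 * gso_sq b j)"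
proof -
  let ?c = "deep_insert i k b"
  have "(\<Sum>j\<in>{1..<i}. (mu ?c i j)\<^sup>2 * gso_sq ?c j) = (\<Sum>j\<in>{1..<i}. (mu b k j)\<^sup>2 * gso_sq b j)"
    by (intro sum.cong) (auto simp: mu_def gso_sq_def gso_deep_insert_below, simp add: deep_insert_def)
  moreover have "?c i = b k" by (simp add: deep_insert_def)
  ultimately show ?thesis using norm_sq_gso[OF assms, of ?c] by simp
qed

text \<open>The third assumption is the loop invariant, with the start \<open>m\<close> kept general
  for the induction: \<open>C\<close> is the squared length that \<open>b k\<close> would contribute
  if inserted at \<open>m\<close>.\<close>

lemma deep_loop_Some:
  assumes "deep_loop \<delta> b k C [m..<k] = Some i" "1 \<le> m"
    and "C = (norm (b k))\<^sup>2 - (\<Sum>j\<in>{1..<m}. (mu b k j)\<^sup>2 * gso_sq b j)"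
  shows "1 \<le> i \<and> i < k \<and> gso_sq (deep_insert i k b) i < \<delta> * gso_sq b i"
  using assms
proof (induction "k - m" arbitrary: m C)
  case 0
  then show ?case by simp
next
  case (Suc l)
  then have upt: "[m..<k] = m # [Suc m..<k]" by (simp add: upt_conv_Cons)
  have ins: "{1..<Suc m} = insert m {1..<m}" using Suc by auto
  show ?case
  proof (cases "C \<ge> \<delta> * gso_sq b m")
    case True
    then have "deep_loop \<delta> b k (C - (mu b k m)\<^sup>2 * gso_sq b m) [Suc m..<k] = Some i"
      using Suc.prems(1) unfolding upt by (simp add: gso_sq_def)
    then show ?thesis
      by (rule Suc.hyps(1)[rotated]) (use Suc in \<open>simp_all add: ins\<close>)
  next
    case False
    then have "i = m" using Suc.prems(1) unfolding upt by (simp add: gso_sq_def)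
    moreover have "m < k" using Suc.hyps by simp
    ultimately show ?thesis using Suc.prems False by (simp add: gso_sq_deep_insert_at)
  qed
qed

text \<open>Strictness comes from taking the largest minimizer: otherwise \<open>Suc i\<close> would
  be a minimizer as well. The premise \<open>Suc i < k\<close> keeps \<open>Suc i\<close> among the
  candidates; the case \<open>Suc i = k\<close> is left to the acceptance test.\<close>

lemma last_arg_min_less:
  fixes f :: "nat \<Rightarrow> real"
  assumes "2 \<le> k" and i: "i = Max {i. is_arg_min f (\<lambda>i. i \<in> {1..k - 1}) i}"
  shows "1 \<le> i" "i < k" "Suc i < k \<Longrightarrow> f i < f (Suc i)"
proof -
  let ?A = "{i. is_arg_min f (\<lambda>i. i \<in> {1..k - 1}) i}"
  have sub: "?A \<subseteq> {1..k - 1}" by (auto simp: is_arg_min_def)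
  then have fin: "finite ?A" by (rule finite_subset) simp
  have "\<exists>x. is_arg_min f (\<lambda>x. x \<in> {1..k - 1}) x"
    by (rule ex_is_arg_min_if_finite) (use assms in auto)
  then have "i \<in> ?A" unfolding i by (intro Max_in fin) auto
  with sub have "i \<in> {1..k - 1}" by blast
  then show "1 \<le> i" "i < k" using assms(1) by auto
  assume "Suc i < k"
  show "f i < f (Suc i)"
  proof (rule ccontr)
    assume "\<not> f i < f (Suc i)"
    then have "Suc i \<in> ?A"
      using \<open>i \<in> ?A\<close> \<open>Suc i < k\<close> by (auto simp: is_arg_min_linorder)
    then have "Suc i \<le> i" using i fin by (metis Max_ge)
    then show False by simp
  qed
qed

lemma swap_test_Some:
  assumes "swap_test alg n \<delta> b k = Some i" "admissible alg \<delta>" "2 \<le> k" "k \<le> n"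
    and nz: "\<And>j. 1 \<le> j \<Longrightarrow> j \<le> n \<Longrightarrow> gso b j \<noteq> 0"
  shows "1 \<le> i \<and> i < k \<and> gso_sq (deep_insert i k b) i < gso_sq b i"
proof -
  have \<delta>: "0 < \<delta>" "\<delta> \<le> 1" using assms(2) by (cases alg; simp)+
  then have scale: "\<delta> * gso_sq b j \<le> gso_sq b j" for j
    by (simp add: gso_sq_def mult_left_le_one_le)
  have cnz: "gso (deep_insert (Suc i) k b) j \<noteq> 0" if "1 \<le> i" "i < k" "1 \<le> j" "j \<le> n" for i j
    using gso_deep_insert_bounds[of "Suc i" k n b "Max (gso_sq b ` {1..n})"] that assms nz by simp
  \<comment> \<open>Insertion at \<open>Suc i\<close> does not affect position \<open>i\<close>, so
    comparing the insertions at \<open>i\<close> and \<open>Suc i\<close> there amounts to comparing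
    with \<open>b\<close> itself.\<close>
  have below: "gso_sq (deep_insert (Suc i) k b) i = gso_sq b i" if "1 \<le> i" for i
    using that by (simp add: gso_sq_def gso_deep_insert_below)
  show ?thesis
  proof (cases alg)
    case LLL
    then have i: "i = k - 1" and
      less: "gso_sq b k < (\<delta> - (mu b k (k - 1))\<^sup>2) * gso_sq b (k - 1)"
      using assms(1) by (auto simp: lll_test_def split: if_splits)
    have k: "Suc i = k" using i assms(3) by simp
    then have "gso_sq (deep_insert i k b) i < \<delta> * gso_sq b i"
      using gso_sq_adjacent_swap_first[of i _ b] less i assms(3)
      by (auto simp: algebra_simps)
    then show ?thesis using scale[of i] i assms(3) by auto
  next
    case DeepLLL
    then have "deep_loop \<delta> b k ((norm (b k))\<^sup>2) [1..<k] = Some i"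
      using assms(1) by (simp add: deep_test_def)
    from deep_loop_Some[OF this] show ?thesis using scale[of i] by auto
  next
    case PotLLL
    define f where "f = (\<lambda>i. Pot n (deep_insert i k b))"
    have i: "i = Max {i. is_arg_min f (\<lambda>i. i \<in> {1..k - 1}) i}" and
      less: "f i < \<delta> * Pot n b"
      using assms(1) PotLLL by (auto simp: pot_test_def Let_def f_def split: if_splits)
    note ik = last_arg_min_less(1,2)[OF assms(3) i]
    have "Pot n b \<ge> 0" by (auto simp: Pot_def gso_sq_def intro!: prod_nonneg)
    \<comment> \<open>Here \<open>f k\<close> is the potential of \<open>b\<close>, as insertion at
      \<open>k\<close> is the identity. This settles the case \<open>Suc i = k\<close> below, and
      the strict test gives a strict drop even for \<open>\<delta> = 1\<close>.\<close>
    then have "f i < f k" using less \<delta> mult_left_le_one_le[of "Pot n b" \<delta>] by (simp add: f_def)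
    then have "f i < f (Suc i)"
      using last_arg_min_less(3)[OF assms(3) i] ik by (cases "Suc i = k") auto
    then have "gso_sq (deep_insert i k b) i < gso_sq (deep_insert (Suc i) k b) i"
      using Pot_adjacent_swap_less[OF ik(1), of n "deep_insert (Suc i) k b"] ik assms(4) cnz[OF ik]
      by (simp add: f_def deep_insert_step[OF ik(2)])
    then show ?thesis using ik below by simp
  next
    case S2LLL
    define f where "f = (\<lambda>i. SS n (deep_insert i k b) - SS n b)"
    have f_eq: "SS_diff n b i k = - f i" for i by (simp add: SS_diff_def f_def)
    \<comment> \<open>Maximizing the decrease of the sum is minimizing \<open>f\<close>, which makes
      \<open>last_arg_min_less\<close> applicable.\<close>
    have "is_arg_max (\<lambda>i. - f i) (\<lambda>i. i \<in> {1..k - 1}) = is_arg_min f (\<lambda>i. i \<in> {1..k - 1})"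
      by (auto simp: is_arg_max_def is_arg_min_def fun_eq_iff)
    then have i: "i = Max {i. is_arg_min f (\<lambda>i. i \<in> {1..k - 1}) i}" and
      less: "- f i > (1 - \<delta>) * SS n b"
      using assms(1) S2LLL by (auto simp: s2_test_def Let_def f_eq split: if_splits)
    note ik = last_arg_min_less(1,2)[OF assms(3) i]
    have "SS n b \<ge> 0" by (auto simp: SS_def gso_sq_def intro!: sum_nonneg)
    then have "(1 - \<delta>) * SS n b \<ge> 0" using \<delta> by simp
    then have "f i < f k" using less by (simp add: f_def)
    then have "f i < f (Suc i)"
      using last_arg_min_less(3)[OF assms(3) i] ik by (cases "Suc i = k") auto
    then have "gso_sq (deep_insert i k b) i < gso_sq (deep_insert (Suc i) k b) i"
      using SS_adjacent_swap_less[OF ik(1), of n "deep_insert (Suc i) k b"] ik assms(4) cnz[OF ik]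
      by (simp add: f_def deep_insert_step[OF ik(2)])
    then show ?thesis using ik below by simp
  qed
qed

section \<open>Counting lattice vectors\<close>

lemma lattice_of_diff_scale:
  assumes "x \<in> lattice_of n b" "y \<in> lattice_of n b"
  shows "x - real_of_int c *\<^sub>R y \<in> lattice_of n b"
proof -
  obtain v w :: "nat \<Rightarrow> int" where "x = (\<Sum>i\<in>{1..n}. real_of_int (v i) *\<^sub>R b i)"
    "y = (\<Sum>i\<in>{1..n}. real_of_int (w i) *\<^sub>R b i)"
    using assms by (auto simp: lattice_of_def)
  then have "x - real_of_int c *\<^sub>R y = (\<Sum>i\<in>{1..n}. real_of_int (v i - c * w i) *\<^sub>R b i)"
    by (simp add: scaleR_sum_right sum_subtractf[symmetric] scaleR_diff_left)
  then show ?thesis unfolding lattice_of_def by (intro CollectI exI[of _ "\<lambda>i. v i - c * w i"]) simp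
qed

lemma basis_in_lattice_of:
  assumes "1 \<le> j" "j \<le> n"
  shows "b j \<in> lattice_of n b"
proof -
  have "(\<Sum>i\<in>{1..n}. real_of_int (if i = j then 1 else 0) *\<^sub>R b i)
      = (\<Sum>i\<in>{1..n}. if i = j then b i else 0)"
    by (rule sum.cong) auto
  also have "\<dots> = b j" using assms by simp
  finally show ?thesis
    unfolding lattice_of_def by (intro CollectI exI[of _ "\<lambda>i. if i = j then 1 else 0"]) simp
qed

lemma lattice_of_Suc_cases:
  assumes "x \<in> lattice_of (Suc n) b"
  obtains y c where "y \<in> lattice_of n b" "x = y + real_of_int c *\<^sub>R b (Suc n)"
proof -
  obtain v :: "nat \<Rightarrow> int" where "x = (\<Sum>i\<in>{1..Suc n}. real_of_int (v i) *\<^sub>R b i)"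
    using assms by (auto simp: lattice_of_def)
  then have "x = (\<Sum>i\<in>{1..n}. real_of_int (v i) *\<^sub>R b i) + real_of_int (v (Suc n)) *\<^sub>R b (Suc n)"
    by simp
  moreover have "(\<Sum>i\<in>{1..n}. real_of_int (v i) *\<^sub>R b i) \<in> lattice_of n b"
    by (auto simp: lattice_of_def)
  ultimately show ?thesis using that by blast
qed

lemma lattice_of_inner_zero:
  assumes "v \<in> lattice_of n b" and "\<And>j. 1 \<le> j \<Longrightarrow> j \<le> n \<Longrightarrow> w \<bullet> b j = 0"
  shows "w \<bullet> v = 0"
  using assms by (auto simp: lattice_of_def inner_sum_right)

lemma card_ints_near:
  assumes "r \<ge> 0"
  shows "finite {c::int. \<bar>real_of_int c + a\<bar> \<le> r}" (is "finite ?S")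
    and "real (card {c::int. \<bar>real_of_int c + a\<bar> \<le> r}) \<le> 2 * r + 1"
proof -
  have eq: "?S = {\<lceil>- a - r\<rceil>..\<lfloor>- a + r\<rfloor>}"
    by (auto simp: abs_le_iff ceiling_le_iff le_floor_iff)
  show "finite ?S" unfolding eq by simp
  have "real (card ?S) = real (nat (\<lfloor>- a + r\<rfloor> + 1 - \<lceil>- a - r\<rceil>))" unfolding eq by simp
  also have "\<dots> \<le> 2 * r + 1"
    using assms by (cases "\<lfloor>- a + r\<rfloor> + 1 \<ge> \<lceil>- a - r\<rceil>") (simp_all, linarith)
  finally show "real (card ?S) \<le> 2 * r + 1" .
qed

text \<open>The lattice is sliced by the coefficient \<open>c\<close> of the last basis vector. The
  inner product with the last Gram-Schmidt vector sees only this coefficient, and Cauchy-Schwarz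
  confines it to an interval of radius \<open>R / norm g\<close>. Each slice is a shifted ball in
  the lattice of one rank less, whence the arbitrary shift \<open>x\<close>.\<close>

lemma card_lattice_ball:
  fixes b :: "nat \<Rightarrow> 'a::real_inner"
  assumes "R \<ge> 0" and "\<And>j. 1 \<le> j \<Longrightarrow> j \<le> n \<Longrightarrow> gso b j \<noteq> 0"
  shows "finite {v \<in> lattice_of n b. norm (x + v) \<le> R} \<and>
    real (card {v \<in> lattice_of n b. norm (x + v) \<le> R}) \<le> (\<Prod>j\<in>{1..n}. 2 * R / norm (gso b j) + 1)"
  using assms(2)
proof (induction n arbitrary: x)
  case 0
  have "{v \<in> lattice_of 0 b. norm (x + v) \<le> R} \<subseteq> {0}" by (auto simp: lattice_of_def)
  from card_mono[OF _ this] finite_subset[OF this] show ?case by simp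
next
  case (Suc n)
  define g where "g = gso b (Suc n)"
  define A where "A = (\<lambda>x. {v \<in> lattice_of n b. norm (x + v) \<le> R})"
  define I where "I = {c::int. \<bar>real_of_int c + (g \<bullet> x) / (norm g)\<^sup>2\<bar> \<le> R / norm g}"
  define f where "f = (\<lambda>c::int. (\<lambda>v. v + real_of_int c *\<^sub>R b (Suc n)) ` A (x + real_of_int c *\<^sub>R b (Suc n)))"
  define p where "p = (\<Prod>j\<in>{1..n}. 2 * R / norm (gso b j) + 1)"
  have "g \<noteq> 0" using Suc.prems by (simp add: g_def)
  have A: "finite (A y)" "real (card (A y)) \<le> p" for y
    using Suc.IH[of y] Suc.prems by (auto simp: A_def p_def)
  have I: "finite I" "real (card I) \<le> 2 * R / norm g + 1"
    unfolding I_def using card_ints_near[of "R / norm g"] assms(1) by auto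
  have "p \<ge> 0" unfolding p_def using assms(1) by (intro prod_nonneg) auto
  have sub: "{v \<in> lattice_of (Suc n) b. norm (x + v) \<le> R} \<subseteq> (\<Union>c\<in>I. f c)"
  proof
    fix v assume "v \<in> {v \<in> lattice_of (Suc n) b. norm (x + v) \<le> R}"
    then have v: "v \<in> lattice_of (Suc n) b" "norm (x + v) \<le> R" by auto
    from v(1) obtain y c where y: "y \<in> lattice_of n b" "v = y + real_of_int c *\<^sub>R b (Suc n)"
      by (rule lattice_of_Suc_cases)
    have "g \<bullet> y = 0"
      using y(1) by (rule lattice_of_inner_zero) (auto simp: g_def gso_orthogonal_vec)
    moreover have "g \<bullet> b (Suc n) = (norm g)\<^sup>2"
      unfolding g_def gso_inner_self by (simp add: gso_sq_def)
    ultimately have "g \<bullet> (x + v) = g \<bullet> x + real_of_int c * (norm g)\<^sup>2"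
      by (simp add: y(2) inner_add_right)
    moreover have "\<bar>g \<bullet> (x + v)\<bar> \<le> norm g * norm (x + v)" by (rule Cauchy_Schwarz_ineq2)
    moreover have "norm g * norm (x + v) \<le> norm g * R" using v(2) by (simp add: mult_left_mono)
    ultimately have le: "\<bar>g \<bullet> x + real_of_int c * (norm g)\<^sup>2\<bar> \<le> norm g * R" by simp
    have "real_of_int c + (g \<bullet> x) / (norm g)\<^sup>2 = (g \<bullet> x + real_of_int c * (norm g)\<^sup>2) / (norm g)\<^sup>2"
      using \<open>g \<noteq> 0\<close> by (simp add: field_simps)
    then have "\<bar>real_of_int c + (g \<bullet> x) / (norm g)\<^sup>2\<bar> \<le> norm g * R / (norm g)\<^sup>2"
      using le by (simp add: divide_right_mono)
    also have "\<dots> = R / norm g" by (simp add: power2_eq_square)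
    finally have "c \<in> I" by (simp add: I_def)
    moreover have "y \<in> A (x + real_of_int c *\<^sub>R b (Suc n))"
      using y v(2) by (simp add: A_def algebra_simps)
    ultimately show "v \<in> (\<Union>c\<in>I. f c)" unfolding f_def y(2) by blast
  qed
  have fin: "finite (\<Union>c\<in>I. f c)" using A(1) I(1) by (auto simp: f_def)
  have "card {v \<in> lattice_of (Suc n) b. norm (x + v) \<le> R} \<le> card (\<Union>c\<in>I. f c)"
    by (rule card_mono[OF fin sub])
  also have "\<dots> \<le> (\<Sum>c\<in>I. card (f c))" by (rule card_UN_le[OF I(1)])
  finally have "real (card {v \<in> lattice_of (Suc n) b. norm (x + v) \<le> R}) \<le> (\<Sum>c\<in>I. real (card (f c)))"
    by (metis of_nat_le_iff of_nat_sum)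
  also have "\<dots> \<le> (\<Sum>c\<in>I. p)"
  proof (rule sum_mono)
    fix c
    have "card (f c) \<le> card (A (x + real_of_int c *\<^sub>R b (Suc n)))"
      unfolding f_def by (rule card_image_le[OF A(1)])
    then show "real (card (f c)) \<le> p" using A(2) by (meson of_nat_mono order_trans)
  qed
  also have "\<dots> = real (card I) * p" by simp
  also have "\<dots> \<le> (2 * R / norm g + 1) * p" using I(2) \<open>p \<ge> 0\<close> by (rule mult_right_mono)
  also have "\<dots> = (\<Prod>j\<in>{1..Suc n}. 2 * R / norm (gso b j) + 1)" by (simp add: p_def g_def)
  finally show ?case using finite_subset[OF sub fin] by simp
qed

section \<open>Halting\<close>

text \<open>While the loop runs, \<open>V\<close> plus the number of executed blocks stays at most
  \<open>V s\<close>. The number \<open>N\<close> is the first time at which \<open>k\<close>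
  exceeds \<open>n\<close>, and the invariant bound forces the value \<open>n + 1\<close>
  then.\<close>

lemma while_halts:
  fixes f :: "'s \<Rightarrow> 's" and k V :: "'s \<Rightarrow> nat"
  assumes "I s" "k s \<le> n + 1"
    and step: "\<And>s. I s \<Longrightarrow> k s \<le> n \<Longrightarrow> I (f s) \<and> k (f s) \<le> n + 1 \<and> V (f s) < V s"
  shows "\<exists>N\<le>V s. (\<forall>t<N. k ((f ^^ t) s) \<le> n) \<and> k ((f ^^ N) s) = n + 1"
proof -
  have run: "I ((f ^^ t) s) \<and> k ((f ^^ t) s) \<le> n + 1 \<and> V ((f ^^ t) s) + t \<le> V s"
    if "\<forall>u<t. k ((f ^^ u) s) \<le> n" for t
    using that
  proof (induction t)
    case 0
    then show ?case using assms by simp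
  next
    case (Suc t)
    then show ?case using step[of "(f ^^ t) s"] by fastforce
  qed
  have "\<exists>t. \<not> k ((f ^^ t) s) \<le> n"
  proof (rule ccontr)
    assume "\<nexists>t. \<not> k ((f ^^ t) s) \<le> n"
    then have "V ((f ^^ Suc (V s)) s) + Suc (V s) \<le> V s" using run by blast
    then show False by simp
  qed
  then obtain N where N: "\<not> k ((f ^^ N) s) \<le> n" "\<forall>t<N. k ((f ^^ t) s) \<le> n"
    using exists_least_iff[of "\<lambda>t. \<not> k ((f ^^ t) s) \<le> n"] by auto
  with run[of N] show ?thesis by (intro exI[of _ N]) auto
qed

section \<open>Lexicographic order on real tuples and ranks in finite sets\<close>

definition lex_less :: "nat \<Rightarrow> (nat \<Rightarrow> real) \<Rightarrow> (nat \<Rightarrow> real) \<Rightarrow> bool" where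
  "lex_less m f g \<longleftrightarrow> (\<exists>i\<in>{1..m}. (\<forall>j\<in>{1..<i}. f j = g j) \<and> f i < g i)"

lemma lex_less_irrefl: "\<not> lex_less m f f"
  by (auto simp: lex_less_def)

lemma lex_less_trans:
  assumes "lex_less m f g" "lex_less m g h"
  shows "lex_less m f h"
proof -
  obtain i where i: "i \<in> {1..m}" "\<And>j. j \<in> {1..<i} \<Longrightarrow> f j = g j" "f i < g i"
    using assms(1) by (auto simp: lex_less_def)
  obtain l where l: "l \<in> {1..m}" "\<And>j. j \<in> {1..<l} \<Longrightarrow> g j = h j" "g l < h l"
    using assms(2) by (auto simp: lex_less_def)
  have "f (min i l) < h (min i l)"
    using i l by (cases i l rule: linorder_cases) (auto simp: min_def)
  moreover have "f j = h j" if "j \<in> {1..<min i l}" for j using that i l by auto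
  ultimately show ?thesis using i(1) l(1) by (auto simp: lex_less_def intro!: bexI[of _ "min i l"])
qed

text \<open>The lexicographic order on real tuples is not well-founded; counting the smaller
  elements of a finite set \<open>H\<close> of attainable tuples turns descent into descent of a
  natural number.\<close>

definition lex_rank :: "nat \<Rightarrow> (nat \<Rightarrow> real) set \<Rightarrow> (nat \<Rightarrow> real) \<Rightarrow> nat" where
  "lex_rank m H h = card {g \<in> H. lex_less m g h}"

lemma lex_rank_strict:
  assumes "finite H" "g \<in> H" "lex_less m g h"
  shows "lex_rank m H g < lex_rank m H h"
  unfolding lex_rank_def
proof (rule psubset_card_mono)
  show "{f \<in> H. lex_less m f g} \<subset> {f \<in> H. lex_less m f h}"
    using assms lex_less_trans[of m _ g h] lex_less_irrefl[of m g] by blast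
qed (use assms in simp)

lemma lex_rank_less_card:
  assumes "finite H" "h \<in> H"
  shows "lex_rank m H h < card H"
  unfolding lex_rank_def
  by (rule psubset_card_mono) (use assms lex_less_irrefl in blast)+

section \<open>Invariant of a run and the tuples that decrease\<close>

definition bounded_in :: "nat \<Rightarrow> 'a::real_inner set \<Rightarrow> real \<Rightarrow> (nat \<Rightarrow> 'a) \<Rightarrow> bool" where
  "bounded_in n L M b \<longleftrightarrow> (\<forall>j. 1 \<le> j \<and> j \<le> n \<longrightarrow> b j \<in> L \<and> gso b j \<noteq> 0 \<and> gso_sq b j \<le> M\<^sup>2)"

text \<open>Used with \<open>m = n - 1\<close>, since a swap at \<open>(i, k)\<close> has
  \<open>i < k\<close> and \<open>k \<le> n\<close>. The restriction makes keys equal as functions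
  as soon as they agree on the relevant indices.\<close>

definition gso_key :: "nat \<Rightarrow> (nat \<Rightarrow> 'a::real_inner) \<Rightarrow> nat \<Rightarrow> real" where
  "gso_key m b = restrict (gso_sq b) {1..m}"

text \<open>The radius bounds a size-reduced vector: with all squared Gram-Schmidt lengths at most
  the square of \<open>M\<close> and coefficients at most \<open>1/2\<close>, its squared norm is at
  most that square times \<open>1 + (j - 1) / 4 = (j + 3) / 4\<close>.\<close>

definition reduced_tuples :: "nat \<Rightarrow> 'a::real_inner set \<Rightarrow> real \<Rightarrow> (nat \<Rightarrow> 'a) set" where
  "reduced_tuples m L M = (\<Pi>\<^sub>E j\<in>{1..m}. {v \<in> L. norm v \<le> M * sqrt (real j + 3) / 2})"

context
  fixes rnd :: "real \<Rightarrow> int" and L :: "'a::real_inner set" and M :: real and n :: nat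
  assumes rnd: "nearest_rounding rnd"
    and L: "\<And>x y c. x \<in> L \<Longrightarrow> y \<in> L \<Longrightarrow> x - real_of_int c *\<^sub>R y \<in> L"
    and M: "0 \<le> M"
begin

lemma bounded_in_size_reduce:
  assumes "bounded_in n L M b"
  shows "gso (size_reduce rnd n b) = gso b" "bounded_in n L M (size_reduce rnd n b)"
    and "\<And>i j. 1 \<le> j \<Longrightarrow> j < i \<Longrightarrow> i \<le> n \<Longrightarrow> \<bar>mu (size_reduce rnd n b) i j\<bar> \<le> 1/2"
  using size_reduce_correct[OF rnd, of n b L] assms L by (auto simp: bounded_in_def gso_sq_def)

lemma norm_size_reduce:
  assumes "bounded_in n L M b" "1 \<le> i" "i \<le> n"
  shows "norm (size_reduce rnd n b i) \<le> M * sqrt (real i + 3) / 2"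
proof -
  let ?b = "size_reduce rnd n b"
  have B: "gso_sq ?b j \<le> M\<^sup>2" if "1 \<le> j" "j \<le> n" for j
    using bounded_in_size_reduce(2)[OF assms(1)] that by (simp add: bounded_in_def)
  have "(norm (?b i))\<^sup>2 = gso_sq ?b i + (\<Sum>j\<in>{1..<i}. (mu ?b i j)\<^sup>2 * gso_sq ?b j)"
    by (rule norm_sq_gso[OF assms(2)])
  also have "\<dots> \<le> M\<^sup>2 + (\<Sum>j\<in>{1..<i}. (1/2)\<^sup>2 * M\<^sup>2)"
  proof (intro add_mono sum_mono mult_mono)
    fix j assume j: "j \<in> {1..<i}"
    then have "\<bar>mu ?b i j\<bar> \<le> \<bar>1/2\<bar>"
      using bounded_in_size_reduce(3)[OF assms(1), of j i] assms by simp
    then show "(mu ?b i j)\<^sup>2 \<le> (1/2)\<^sup>2" by (simp only: abs_le_square_iff)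
  qed (use B assms in \<open>auto simp: gso_sq_def\<close>)
  also have "\<dots> = M\<^sup>2 * (real i + 3) / 4"
    using assms(2) by (simp add: power2_eq_square field_simps)
  also have "\<dots> = (M * sqrt (real i + 3) / 2)\<^sup>2"
    by (simp add: power_mult_distrib power_divide)
  finally show ?thesis by (rule power2_le_imp_le) (use M in simp)
qed

text \<open>Although \<open>b\<close> itself may have long vectors, its size-reduced form has the
  same Gram-Schmidt vectors, and the first \<open>m\<close> of these depend on the first
  \<open>m\<close> vectors only.\<close>

lemma gso_key_reduced_tuples:
  assumes "bounded_in n L M b" "m \<le> n"
  shows "gso_key m b \<in> gso_key m ` reduced_tuples m L M"
proof (rule image_eqI)
  let ?x = "restrict (size_reduce rnd n b) {1..m}"
  show "?x \<in> reduced_tuples m L M"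
    unfolding reduced_tuples_def
    using norm_size_reduce[OF assms(1)] bounded_in_size_reduce(2)[OF assms(1)] assms(2)
    by (auto simp: bounded_in_def)
  have "gso ?x j = gso (size_reduce rnd n b) j" if "j \<in> {1..m}" for j
    by (rule gso_cong) (use that in auto)
  then show "gso_key m b = gso_key m ?x"
    unfolding gso_key_def bounded_in_size_reduce(1)[OF assms(1)]
    by (intro restrict_ext) (simp add: gso_sq_def)
qed

text \<open>The position \<open>i\<close> exempted in \<open>gso_deep_insert_bounds\<close> is
  controlled here by the strict decrease that the swap test guarantees.\<close>

lemma bounded_in_swap:
  assumes b: "bounded_in n L M b" and i: "1 \<le> i" "i < k" "k \<le> n"
    and less: "gso_sq (deep_insert i k b) i < gso_sq b i"
  shows "bounded_in n L M (deep_insert i k b)"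
    and "lex_less (n - 1) (gso_key (n - 1) (deep_insert i k b)) (gso_key (n - 1) b)"
proof -
  let ?c = "deep_insert i k b"
  have "b j \<in> L" if "1 \<le> j" "j \<le> n" for j
    using b that by (simp add: bounded_in_def)
  then have "?c j \<in> L" if "1 \<le> j" "j \<le> n" for j
    using i that by (auto simp: deep_insert_def)
  moreover have "gso ?c j \<noteq> 0 \<and> (j \<noteq> i \<longrightarrow> gso_sq ?c j \<le> M\<^sup>2)" if "1 \<le> j" "j \<le> n" for j
    using gso_deep_insert_bounds[of i k n b "M\<^sup>2"] b i that by (auto simp: bounded_in_def)
  moreover have "gso_sq ?c i \<le> M\<^sup>2"
    using less b i by (force simp: bounded_in_def)
  ultimately show "bounded_in n L M ?c" by (auto simp: bounded_in_def)
  show "lex_less (n - 1) (gso_key (n - 1) ?c) (gso_key (n - 1) b)"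
    unfolding lex_less_def
  proof (intro bexI[of _ i] conjI ballI)
    show "i \<in> {1..n - 1}" using i by auto
    then show "gso_key (n - 1) ?c i < gso_key (n - 1) b i" using less by (simp add: gso_key_def)
    show "gso_key (n - 1) ?c j = gso_key (n - 1) b j" if "j \<in> {1..<i}" for j
      using that by (simp add: gso_key_def gso_sq_def gso_deep_insert_below restrict_def)
  qed
qed

lemma halts_within:
  assumes n: "2 \<le> n" and B: "bounded_in n L M B" and adm: "admissible alg \<delta>"
    and fin: "finite (reduced_tuples (n - 1) L M)"
  shows "\<exists>N. halts_after alg rnd n \<delta> B N \<and> N \<le> (n - 1) * card (reduced_tuples (n - 1) L M)"
proof -
  define H where "H = gso_key (n - 1) ` reduced_tuples (n - 1) L M"
  define rank where "rank = (\<lambda>b :: nat \<Rightarrow> 'a. lex_rank (n - 1) H (gso_key (n - 1) b))"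
  \<comment> \<open>An increase of \<open>k\<close> keeps the rank and lowers the second summand by
    1. A swap lowers the rank, which gains at least \<open>n - 1\<close>, while the second summand
    goes from at least 1 to at most \<open>n - 1\<close>, as the new index is at least 2.\<close>
  define V where "V = (\<lambda>(b, k). (n - 1) * rank b + (n + 1 - k))"
  define Inv where "Inv = (\<lambda>(b :: nat \<Rightarrow> 'a, k :: nat). bounded_in n L M b \<and> 2 \<le> k)"
  have finH: "finite H" using fin by (simp add: H_def)
  have keyH: "gso_key (n - 1) b \<in> H" if "bounded_in n L M b" for b
    unfolding H_def using that by (rule gso_key_reduced_tuples) simp
  have step: "Inv (while_block alg rnd n \<delta> s) \<and> snd (while_block alg rnd n \<delta> s) \<le> n + 1 \<and>
      V (while_block alg rnd n \<delta> s) < V s" if "Inv s" "snd s \<le> n" for s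
  proof -
    obtain b k where s: "s = (b, k)" by (cases s)
    define b' where "b' = size_reduce rnd n b"
    have b: "bounded_in n L M b" "2 \<le> k" "k \<le> n" using that by (auto simp: s Inv_def)
    note b' = bounded_in_size_reduce(1,2)[OF b(1), folded b'_def]
    have key: "gso_key (n - 1) b' = gso_key (n - 1) b"
      unfolding gso_key_def by (intro restrict_ext) (simp add: gso_sq_def b'(1))
    show ?thesis
    proof (cases "swap_test alg n \<delta> b' k")
      case None
      then have "while_block alg rnd n \<delta> s = (b', k + 1)"
        by (simp add: while_block_def s Let_def b'_def)
      then show ?thesis using b b' key by (simp add: s Inv_def V_def rank_def)
    next
      case (Some i)
      let ?c = "deep_insert i k b'"
      have w: "while_block alg rnd n \<delta> s = (?c, max i 2)"
        using Some by (simp add: while_block_def s Let_def b'_def)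
      have i: "1 \<le> i" "i < k" "gso_sq ?c i < gso_sq b' i"
        using swap_test_Some[OF Some adm b(2,3)] b'(2) by (auto simp: bounded_in_def)
      note c = bounded_in_swap[OF b'(2) i(1,2) b(3) i(3)]
      have "rank ?c < rank b"
        unfolding rank_def using c keyH finH key by (auto intro!: lex_rank_strict)
      then have "(n - 1) * (rank ?c + 1) \<le> (n - 1) * rank b" by (intro mult_left_mono) auto
      then have "(n - 1) * rank ?c + (n - 1) \<le> (n - 1) * rank b" by simp
      then show ?thesis
        unfolding w using i b c by (auto simp: s Inv_def V_def)
    qed
  qed
  have "\<exists>N\<le>V (B, 2). (\<forall>t<N. snd ((while_block alg rnd n \<delta> ^^ t) (B, 2)) \<le> n) \<and>
      snd ((while_block alg rnd n \<delta> ^^ N) (B, 2)) = n + 1"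
    by (rule while_halts[where I = Inv]) (use step B n in \<open>auto simp: Inv_def\<close>)
  then obtain N where N: "N \<le> V (B, 2)" "halts_after alg rnd n \<delta> B N"
    unfolding halts_after_def by blast
  have "rank B < card H" unfolding rank_def by (rule lex_rank_less_card[OF finH keyH[OF B]])
  then have "(n - 1) * (rank B + 1) \<le> (n - 1) * card H" by (intro mult_left_mono) auto
  \<comment> \<open>The start at \<open>k = 2\<close> contributes \<open>n - 1\<close>, which is
    absorbed because the rank is at most \<open>card H - 1\<close>.\<close>
  moreover have "V (B, 2) = (n - 1) * (rank B + 1)" using n by (simp add: V_def)
  moreover have "(n - 1) * card H \<le> (n - 1) * card (reduced_tuples (n - 1) L M)"
    unfolding H_def using card_image_le[OF fin] by (intro mult_left_mono) auto
  ultimately have "N \<le> (n - 1) * card (reduced_tuples (n - 1) L M)"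
    using N(1) by linarith
  with N(2) show ?thesis by blast
qed

end

text \<open>Since \<open>M / norm (gso B l) \<ge> 1\<close>, the summand 1 in each factor of the
  ball bound can be replaced by this quotient. Every ball then contributes a power of
  \<open>1 + sqrt (j + 3)\<close> times \<open>\<alpha>\<close>, and there are \<open>n - 1\<close>
  balls.\<close>

lemma card_reduced_tuples:
  assumes n: "2 \<le> n" and nz: "\<And>j. 1 \<le> j \<Longrightarrow> j \<le> n \<Longrightarrow> gso B j \<noteq> 0"
    and le: "\<And>j. 1 \<le> j \<Longrightarrow> j \<le> n \<Longrightarrow> norm (gso B j) \<le> M"
  defines "\<alpha> \<equiv> M ^ n / lattice_vol n B"
  shows "finite (reduced_tuples (n - 1) (lattice_of n B) M)"
    and "real (card (reduced_tuples (n - 1) (lattice_of n B) M))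
      \<le> (3 * (\<Prod>j\<in>{2..n - 1}. 2 + sqrt (real j + 3))) ^ n * \<alpha> ^ (n - 1)"
proof -
  define S where "S = (\<lambda>j::nat. {v \<in> lattice_of n B. norm v \<le> M * sqrt (real j + 3) / 2})"
  have M: "M \<ge> 0" using order_trans[OF norm_ge_zero le[of 1]] n by simp
  have pos: "norm (gso B l) > 0" if "l \<in> {1..n}" for l using nz that by simp
  have vol: "lattice_vol n B > 0"
    unfolding lattice_vol_def using pos by (intro prod_pos) auto
  have S: "finite (S j)" "real (card (S j)) \<le> (1 + sqrt (real j + 3)) ^ n * \<alpha>" for j
  proof -
    have R: "M * sqrt (real j + 3) / 2 \<ge> 0" using M by simp
    note ball = card_lattice_ball[OF R nz, of n 0, simplified]
    show "finite (S j)" using ball by (simp add: S_def)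
    have "real (card (S j)) \<le> (\<Prod>l\<in>{1..n}. M * sqrt (real j + 3) / norm (gso B l) + 1)"
      using ball by (simp add: S_def)
    also have "\<dots> \<le> (\<Prod>l\<in>{1..n}. (1 + sqrt (real j + 3)) * (M / norm (gso B l)))"
    proof (rule prod_mono, intro conjI)
      fix l assume l: "l \<in> {1..n}"
      show "0 \<le> M * sqrt (real j + 3) / norm (gso B l) + 1" using M by simp
      have "1 \<le> M / norm (gso B l)" using le[of l] pos[OF l] l by simp
      then show "M * sqrt (real j + 3) / norm (gso B l) + 1
          \<le> (1 + sqrt (real j + 3)) * (M / norm (gso B l))"
        by (simp add: algebra_simps)
    qed
    also have "\<dots> = (1 + sqrt (real j + 3)) ^ n * \<alpha>"
      by (simp add: prod.distrib prod_dividef power_mult_distrib \<alpha>_def lattice_vol_def)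
    finally show "real (card (S j)) \<le> (1 + sqrt (real j + 3)) ^ n * \<alpha>" .
  qed
  have T: "reduced_tuples (n - 1) (lattice_of n B) M = (\<Pi>\<^sub>E j\<in>{1..n - 1}. S j)"
    by (simp add: reduced_tuples_def S_def)
  show "finite (reduced_tuples (n - 1) (lattice_of n B) M)"
    unfolding T using S(1) by (intro finite_PiE) auto
  have \<alpha>: "\<alpha> \<ge> 0" using M vol by (simp add: \<alpha>_def)
  have "real (card (reduced_tuples (n - 1) (lattice_of n B) M)) = (\<Prod>j\<in>{1..n - 1}. real (card (S j)))"
    unfolding T by (simp add: card_PiE)
  also have "\<dots> \<le> (\<Prod>j\<in>{1..n - 1}. (1 + sqrt (real j + 3)) ^ n * \<alpha>)"
    using S(2) by (intro prod_mono) auto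
  also have "\<dots> = (\<Prod>j\<in>{1..n - 1}. 1 + sqrt (real j + 3)) ^ n * \<alpha> ^ (n - 1)"
    by (simp add: prod.distrib prod_power_distrib)
  \<comment> \<open>The factor for \<open>j = 1\<close> is \<open>1 + sqrt 4 = 3\<close>.\<close>
  also have "(\<Prod>j\<in>{1..n - 1}. 1 + sqrt (real j + 3)) = 3 * (\<Prod>j\<in>{2..n - 1}. 1 + sqrt (real j + 3))"
  proof -
    have "{1..n - 1} = insert 1 {2..n - 1}" using n by auto
    moreover have "sqrt 4 = (2::real)" using real_sqrt_abs[of 2] by simp
    ultimately show ?thesis by simp
  qed
  \<comment> \<open>The count yields \<open>1 + sqrt (j + 3)\<close>; it is relaxed to the
    \<open>2 + sqrt (j + 3)\<close> of the claimed bound.\<close>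
  also have "(3 * (\<Prod>j\<in>{2..n - 1}. 1 + sqrt (real j + 3))) ^ n * \<alpha> ^ (n - 1)
      \<le> (3 * (\<Prod>j\<in>{2..n - 1}. 2 + sqrt (real j + 3))) ^ n * \<alpha> ^ (n - 1)"
    using \<alpha> by (intro mult_right_mono power_mono mult_left_mono prod_mono mult_nonneg_nonneg prod_nonneg) auto
  finally show "real (card (reduced_tuples (n - 1) (lattice_of n B) M))
      \<le> (3 * (\<Prod>j\<in>{2..n - 1}. 2 + sqrt (real j + 3))) ^ n * \<alpha> ^ (n - 1)" .
qed

section \<open>The explicit bounds\<close>

text \<open>The product runs from 5 to \<open>n + 2\<close>, so only 4! = 24 is missing from the
  factorial.\<close>

lemma prod_eq_fact: "2 \<le> n \<Longrightarrow> (\<Prod>j\<in>{2..n - 1}. real j + 3) = fact (n + 2) / 24"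
proof (induction n rule: nat_induct_at_least)
  case base
  show ?case by (simp add: fact_numeral)
next
  case (Suc n)
  have "{2..Suc n - 1} = insert n {2..n - 1}" using Suc by auto
  with Suc show ?case by (simp add: algebra_simps)
qed

lemma prod_sqrt: "(\<Prod>j\<in>A. sqrt (f j)) = sqrt (\<Prod>j\<in>A. f j)"
  by (induction A rule: infinite_finite_induct) (simp_all add: real_sqrt_mult)

lemma sqrt_power_eq_powr: "x > 0 \<Longrightarrow> sqrt x ^ n = x powr (real n / 2)"
  by (simp add: powr_half_sqrt[symmetric] powr_powr flip: powr_realpow)

text \<open>For \<open>j \<ge> 2\<close> one has \<open>sqrt 5 \<le> sqrt (j + 3)\<close>, hence
  \<open>2 \<le> 2 / sqrt 5 * sqrt (j + 3)\<close>; this is the origin of the constant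
  \<open>2 / sqrt 5 + 1\<close>.\<close>

lemma block_bound_le_fact:
  assumes n: "2 \<le> n" and "\<alpha> \<ge> 0"
  shows "block_bound n \<alpha> \<le> block_bound_fact n \<alpha>"
proof -
  define c :: real where "c = 2 / sqrt 5 + 1"
  define F :: real where "F = 3 * fact (n + 2) / 8"
  have "c > 0" unfolding c_def by (intro add_nonneg_pos) auto
  have "F > 0" by (simp add: F_def)
  have "(\<Prod>j\<in>{2..n - 1}. 2 + sqrt (real j + 3)) \<le> (\<Prod>j\<in>{2..n - 1}. c * sqrt (real j + 3))"
  proof (rule prod_mono, intro conjI)
    fix j assume "j \<in> {2..n - 1}"
    then have "sqrt 5 \<le> sqrt (real j + 3)" by simp
    then have "2 / sqrt 5 * sqrt 5 \<le> 2 / sqrt 5 * sqrt (real j + 3)" by (intro mult_left_mono) auto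
    then show "2 + sqrt (real j + 3) \<le> c * sqrt (real j + 3)"
      by (simp add: c_def algebra_simps)
  qed simp
  also have "\<dots> = c ^ (n - 2) * sqrt (fact (n + 2) / 24)"
    unfolding prod.distrib prod_sqrt prod_eq_fact[OF n] by (simp add: numeral_2_eq_2)
  finally have "3 * (\<Prod>j\<in>{2..n - 1}. 2 + sqrt (real j + 3)) \<le> c ^ (n - 2) * (3 * sqrt (fact (n + 2) / 24))"
    by simp
  \<comment> \<open>Moving 3 under the root gives \<open>9 / 24 = 3 / 8\<close>.\<close>
  also have "3 * sqrt (fact (n + 2) / 24) = sqrt F"
  proof -
    have "F = 3\<^sup>2 * (fact (n + 2) / 24)" by (simp add: F_def)
    then show ?thesis by (simp only: real_sqrt_mult real_sqrt_abs)
  qed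
  finally have "(3 * (\<Prod>j\<in>{2..n - 1}. 2 + sqrt (real j + 3))) ^ n \<le> (c ^ (n - 2) * sqrt F) ^ n"
    by (intro power_mono) (auto intro!: prod_nonneg)
  also have "\<dots> = c ^ (n * (n - 2)) * F powr (real n / 2)"
    using \<open>F > 0\<close> by (simp add: power_mult_distrib sqrt_power_eq_powr mult.commute flip: power_mult)
  finally have "(real n - 1) * (3 * (\<Prod>j\<in>{2..n - 1}. 2 + sqrt (real j + 3))) ^ n * \<alpha> ^ (n - 1)
      \<le> (real n - 1) * (c ^ (n * (n - 2)) * F powr (real n / 2)) * \<alpha> ^ (n - 1)"
    using assms by (intro mult_right_mono mult_left_mono) auto
  then show ?thesis
    unfolding block_bound_def block_bound_fact_def c_def F_def by (simp add: mult_ac)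
qed

text \<open>A constant factor is a power of \<open>m\<close> with exponent tending to 0, so
  \<open>exp (- 1/2)\<close> is compensated by the summand \<open>1/2\<close> of \<open>u\<close>.
  The estimate of \<open>(m + 2)!\<close> by \<open>(m + 2) ^ (m + 2)\<close> is therefore precise
  enough, and Stirling's formula can be avoided.\<close>

lemma block_bound_fact_asymptotic:
  "\<exists>\<epsilon> :: nat \<Rightarrow> real. \<epsilon> \<longlonglongrightarrow> 0 \<and>
     (\<forall>m\<ge>2. \<forall>\<beta>\<ge>1. block_bound_fact m \<beta> \<le>
        \<beta> ^ (m - 1) *
          ((2 / sqrt 5 + 1) * exp (- 1/2) * real m powr (1/2 + \<epsilon> m)) ^ (m\<^sup>2))"
proof -
  define c :: real where "c = 2 / sqrt 5 + 1"
  define C where "C = ln c"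
  define u where "u = (\<lambda>x::real. ln (x - 1) / x\<^sup>2 - 2 * C / x + ln (3/8) / (2 * x)
      + (x + 2) * ln (x + 2) / (2 * x) + 1/2)"
  \<comment> \<open>The choice of \<open>u\<close> makes the claimed bound equal to \<open>block_bound_fact\<close> with \<open>(m + 2)!\<close> replaced
    by \<open>(m + 2)\<^bsup>m+2\<^esup>\<close>.\<close>
  define \<epsilon> where "\<epsilon> = (\<lambda>m::nat. u (real m) / ln (real m) - 1/2)"
  have "((\<lambda>x. u x / ln x - 1/2) \<longlongrightarrow> 0) at_top"
    unfolding u_def by real_asymp
  then have lim: "\<epsilon> \<longlonglongrightarrow> 0"
    unfolding \<epsilon>_def by (rule filterlim_compose[OF _ filterlim_real_sequentially])
  have "c > 0" unfolding c_def by (intro add_nonneg_pos) auto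
  then have c: "c = exp C" by (simp add: C_def)
  have main: "block_bound_fact m \<beta> \<le> \<beta> ^ (m - 1) * (c * exp (- 1/2) * real m powr (1/2 + \<epsilon> m)) ^ (m\<^sup>2)"
    if m: "m \<ge> 2" and \<beta>: "\<beta> \<ge> 1" for m \<beta>
  proof -
    define x where "x = real m"
    have x: "x \<ge> 2" using m by (simp add: x_def)
    define F :: real where "F = 3 * fact (m + 2) / 8"
    have "F > 0" by (simp add: F_def)
    have "(fact (m + 2) :: real) \<le> real (m + 2) ^ (m + 2)"
      by (metis fact_le_power of_nat_power)
    then have "ln (fact (m + 2)) \<le> ln (real (m + 2) ^ (m + 2))" by (intro ln_mono) simp_all
    also have "\<dots> = real (m + 2) * ln (real (m + 2))" by (rule ln_realpow)
    also have "real (m + 2) = x + 2" by (simp add: x_def)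
    finally have "ln (fact (m + 2)) \<le> (x + 2) * ln (x + 2)" .
    moreover have "F = (3/8) * fact (m + 2)" by (simp add: F_def)
    then have "ln F = ln (3/8) + ln (fact (m + 2))" by (metis ln_mult_pos fact_gt_zero divide_pos_pos zero_less_numeral)
    ultimately have lnF: "ln F \<le> ln (3/8) + (x + 2) * ln (x + 2)" by simp
    have "(real m - 1) * c ^ (m * (m - 2)) * F powr (real m / 2)
        = exp (ln (x - 1) + x * (x - 2) * C + x / 2 * ln F)"
    proof -
      have "real m - 1 = exp (ln (x - 1))" using x by (simp add: x_def)
      moreover have "c ^ (m * (m - 2)) = exp (x * (x - 2) * C)"
        using m unfolding c by (simp add: x_def flip: exp_of_nat_mult)
      moreover have "F powr (real m / 2) = exp (x / 2 * ln F)"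
        using \<open>F > 0\<close> by (simp add: powr_def x_def)
      ultimately show ?thesis by (simp only: exp_add)
    qed
    also have "\<dots> \<le> exp (x\<^sup>2 * (C - 1/2 + u x))"
    proof -
      have "x / 2 * ln F \<le> x / 2 * (ln (3/8) + (x + 2) * ln (x + 2))"
        using lnF x by (intro mult_left_mono) auto
      moreover have "x\<^sup>2 * (C - 1/2 + u x)
          = ln (x - 1) + x * (x - 2) * C + x / 2 * (ln (3/8) + (x + 2) * ln (x + 2))"
        using x unfolding u_def by (simp add: field_simps power2_eq_square)
      ultimately show ?thesis by simp
    qed
    also have "\<dots> = (c * exp (- 1/2) * real m powr (1/2 + \<epsilon> m)) ^ (m\<^sup>2)"
    proof -
      have "ln x > 0" using x by simp
      then have "u x = (1/2 + \<epsilon> m) * ln x" by (simp add: \<epsilon>_def x_def)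
      then have "real m powr (1/2 + \<epsilon> m) = exp (u x)" using x by (simp add: powr_def x_def)
      then have "c * exp (- 1/2) * real m powr (1/2 + \<epsilon> m) = exp (C - 1/2 + u x)"
        by (simp add: c exp_add[symmetric] exp_diff[symmetric])
      then show ?thesis by (simp add: x_def flip: exp_of_nat_mult)
    qed
    finally have "(real m - 1) * c ^ (m * (m - 2)) * F powr (real m / 2)
        \<le> (c * exp (- 1/2) * real m powr (1/2 + \<epsilon> m)) ^ (m\<^sup>2)" .
    then have "\<beta> ^ (m - 1) * ((real m - 1) * c ^ (m * (m - 2)) * F powr (real m / 2))
        \<le> \<beta> ^ (m - 1) * (c * exp (- 1/2) * real m powr (1/2 + \<epsilon> m)) ^ (m\<^sup>2)"
      using \<beta> by (intro mult_left_mono) auto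
    then show ?thesis
      unfolding block_bound_fact_def c_def F_def by (simp only: mult_ac)
  qed
  show ?thesis
    using lim main unfolding c_def by blast
qed

theorem theorem1:
  fixes B :: "nat \<Rightarrow> real ^ 'n"
    and L :: "(real ^ 'n) set"
    and n :: nat
    and M \<alpha> \<delta> :: real
    and rnd :: "real \<Rightarrow> int"
    and alg :: lll_variant
  assumes "n = CARD('n)" and "n \<ge> 2"
    and "is_lattice_basis n B L"
    and "M = Max ((\<lambda>i. norm (B i)) ` {1..n})"
    and "\<alpha> = M ^ n / lattice_vol n B"
    and "nearest_rounding rnd"
    and "admissible alg \<delta>"
  shows "\<alpha> \<ge> 1
    \<and> (\<exists>N. halts_after alg rnd n \<delta> B N \<and> real N \<le> block_bound n \<alpha>)
    \<and> block_bound n \<alpha> \<le> block_bound_fact n \<alpha>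
    \<and> (\<exists>\<epsilon> :: nat \<Rightarrow> real. \<epsilon> \<longlonglongrightarrow> 0 \<and>
         (\<forall>m\<ge>2. \<forall>\<beta>\<ge>1. block_bound_fact m \<beta> \<le>
            \<beta> ^ (m - 1) *
              ((2 / sqrt 5 + 1) * exp (- 1/2) * real m powr (1/2 + \<epsilon> m)) ^ (m\<^sup>2)))"
proof -
  have L: "L = lattice_of n B" and nz: "\<And>j. 1 \<le> j \<Longrightarrow> j \<le> n \<Longrightarrow> gso B j \<noteq> 0"
    using assms(3) gso_nonzero_if_independent by (auto simp: is_lattice_basis_def)
  have le: "norm (gso B j) \<le> M" if j: "1 \<le> j" "j \<le> n" for j
  proof -
    have "gso_sq B j \<le> (norm (B j))\<^sup>2"
      using norm_sq_gso[OF j(1), of B] by (simp add: gso_sq_def sum_nonneg)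
    then have "norm (gso B j) \<le> norm (B j)" by (simp add: gso_sq_def)
    also have "\<dots> \<le> M" unfolding assms(4) using j by (intro Max_ge) auto
    finally show ?thesis .
  qed
  have M: "0 \<le> M" using order_trans[OF norm_ge_zero le[of 1]] assms(2) by simp
  have vol: "lattice_vol n B > 0"
    unfolding lattice_vol_def using nz by (intro prod_pos) auto
  \<comment> \<open>Hadamard's inequality in the form needed for \<open>\<alpha> \<ge> 1\<close>:
    each Gram-Schmidt vector is no longer than \<open>M\<close>.\<close>
  have "lattice_vol n B \<le> (\<Prod>i\<in>{1..n}. M)"
    unfolding lattice_vol_def using le by (intro prod_mono) auto
  then have \<alpha>: "\<alpha> \<ge> 1" using vol by (simp add: assms(5))
  have "bounded_in n L M B"
    unfolding bounded_in_def gso_sq_def using nz le basis_in_lattice_of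
    by (auto simp: L intro: power_mono)
  then obtain N where N: "halts_after alg rnd n \<delta> B N"
    "N \<le> (n - 1) * card (reduced_tuples (n - 1) L M)"
    using halts_within[OF assms(6), of L M n B alg \<delta>] lattice_of_diff_scale M assms(2,7)
      card_reduced_tuples(1)[OF assms(2) nz le] unfolding L by blast
  have "real N \<le> real ((n - 1) * card (reduced_tuples (n - 1) L M))"
    using N(2) by (rule of_nat_mono)
  also have "\<dots> = (real n - 1) * real (card (reduced_tuples (n - 1) L M))"
    using assms(2) by simp
  also have "\<dots> \<le> (real n - 1) *
      ((3 * (\<Prod>j\<in>{2..n - 1}. 2 + sqrt (real j + 3))) ^ n * \<alpha> ^ (n - 1))"
    unfolding L assms(5) using card_reduced_tuples(2)[OF assms(2) nz le] assms(2)
    by (intro mult_left_mono) auto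
  also have "\<dots> = block_bound n \<alpha>" by (simp add: block_bound_def)
  finally show ?thesis
    using \<alpha> N(1) block_bound_le_fact[OF assms(2), of \<alpha>] block_bound_fact_asymptotic by auto
qed

end
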